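(* Consider the Cauchy problem for the compressible Euler system $$\partial_t(\varrho\mathbf V)+\mathrm{div}_{\mathbf x}(\varrho\mathbf V\otimes\mathbf V)+\nabla_{\mathbf x}p=0,\quad \partial_t\varrho+\mathrm{div}_{\mathbf x}(\varrho\mathbf V)=0,\quad \partial_tS+\mathbf V\cdot\nabla_{\mathbf x}S=0,\quad p=e^S\varrho^\gamma$$ with $C^1$ initial data satisfying $\varrho_0>0$, $p_0>0$ on $\mathbb R^n$ and $(\mathbf V_0,\varrho_0,p_0)(\mathbf x)=(\mathbf 0,\bar\varrho,\bar p)$ for $|\mathbf x|\ge\mathcal R_0$, where $\bar\varrho,\bar p,\mathcal R_0>0$ are constants. Let $R>0$, $k>n$ and denote $$N=\delta e(0)+\omega_nR^n\bar p\left(\frac{k-1}{k}\right)^n\left(\frac{\delta}{\gamma-1}-n\right).$$ Suppose that $\mathcal R_0<\frac{(k-1)R}{k}$ and that the initial data are such that $$0<T_1\le T_2,$$ where $$T_1=\frac1{2BN}\left(G'_\phi(0)+\sqrt{(G'_\phi(0))^2+4BN\,G_\phi(0)}\right),\qquad T_2=\frac1\sigma\left(\frac{(k-1)R}{k}-\mathcal R_0\right)$$ (with $T_1$ real; for $N=0$, $T_1$ is understood as the limit $-G_\phi(0)/G'_\phi(0)$). Then the solution of the Cauchy problem loses its smoothness within time $T_1$ inside the ball $\mathcal B_R$.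
   Context: Unknowns: density $\varrho$, velocity $\mathbf V\in\mathbb R^n$, pressure $p$, entropy $S$, functions of $\mathbf x\in\mathbb R^n$, $t\ge0$; $\gamma>1$ constant. Smoothness means $C^1$. $\delta=\min\{2,n(\gamma-1)\}$; $\omega_n$ is the volume of the unit ball in $\mathbb R^n$; $\sigma=\sqrt{p_\varrho}|_{\varrho=\bar\varrho}=\sqrt{\gamma\bar p/\bar\varrho}$ is the sound speed of the background state. $\mathcal B_{\mathcal R(t)}=\{|\mathbf x|<\mathcal R(t)\}$ with $\mathcal R(t)=\mathcal R_0+\sigma t$, and $$e(t)=\frac12\int_{\mathbb R^n}\varrho|\mathbf V|^2dx+\frac1{\gamma-1}\int_{\mathcal B_{\mathcal R(t)}}(p-\bar p)\,dx.$$ For $R>0$, $k>n$: $\mathcal B_R=\{|\mathbf x|\le R\}$, $B=\frac{k}{R^2(k-1)}$, $C=B(k-1)$, and $\phi\in C^1([0,\infty))$ is $$\phi(r)=\begin{cases}1-Br^2,&0\le r\le R-\frac Rk,\\ C(r-R)^2,&R-\frac Rk<r\le R,\\ 0,&r\ge R.\end{cases}$$ $$G_\phi(t)=\int_{\mathbb R^n}\varrho(\mathbf x,t)\phi(|\mathbf x|)\,dx,\qquad G'_\phi(t)=\int_{\mathbb R^n}\frac{\phi'(|\mathbf x|)}{|\mathbf x|}(\mathbf V\cdot\mathbf x)\varrho\,dx.$$ *)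

theory Defs
  imports "HOL-Analysis.Analysis"
begin

(* Derivatives are taken within U, so that for U = UNIV \<times> {0..<T} the smoothness is up to the
   initial time t = 0 and for U containing points of UNIV \<times> {T} it is up to the final time T. *)
definition C1_on :: "'a::real_normed_vector set \<Rightarrow> ('a \<Rightarrow> 'b::real_normed_vector) \<Rightarrow> bool" where
  "C1_on U f \<longleftrightarrow>
     (\<exists>f' :: 'a \<Rightarrow> 'a \<Rightarrow>\<^sub>L 'b.
        (\<forall>z\<in>U. (f has_derivative blinfun_apply (f' z)) (at z within U)) \<and> continuous_on U f')"

definition pd_t :: "((real^'n) \<times> real \<Rightarrow> real) \<Rightarrow> (real^'n) \<times> real \<Rightarrow> real" where
  "pd_t f z = frechet_derivative f (at z) (0, 1)"

definition pd_x :: "'n \<Rightarrow> ((real^'n) \<times> real \<Rightarrow> real) \<Rightarrow> (real^'n) \<times> real \<Rightarrow> real" where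
  "pd_x j f z = frechet_derivative f (at z) (axis j 1, 0)"

(* Classical (C^1) solutions on a space-time domain \<Omega> \<subseteq> UNIV \<times> {0..}. The equations are imposed at
   interior points; on the rest of \<Omega> they follow by continuity of the first derivatives.
   Only \<rho> \<ge> 0 is demanded: this is what the power with real exponent in the equation of state
   needs, positivity is not presupposed. *)
definition euler_solution ::
  "real \<Rightarrow> ((real^'n) \<times> real) set \<Rightarrow> ((real^'n) \<times> real \<Rightarrow> real) \<Rightarrow> ((real^'n) \<times> real \<Rightarrow> real^'n)
   \<Rightarrow> ((real^'n) \<times> real \<Rightarrow> real) \<Rightarrow> ((real^'n) \<times> real \<Rightarrow> real) \<Rightarrow> bool" where
  "euler_solution \<gamma> \<Omega> \<rho> V p S \<longleftrightarrow>
     C1_on \<Omega> \<rho> \<and> C1_on \<Omega> V \<and> C1_on \<Omega> p \<and> C1_on \<Omega> S \<and>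
     (\<forall>z\<in>\<Omega>. 0 \<le> \<rho> z \<and> p z = exp (S z) * \<rho> z powr \<gamma>) \<and>
     (\<forall>z\<in>interior \<Omega>.
        (\<forall>i. pd_t (\<lambda>y. \<rho> y * V y $ i) z
             + (\<Sum>j\<in>UNIV. pd_x j (\<lambda>y. \<rho> y * V y $ i * V y $ j) z) + pd_x i p z = 0) \<and>
        pd_t \<rho> z + (\<Sum>j\<in>UNIV. pd_x j (\<lambda>y. \<rho> y * V y $ j) z) = 0 \<and>
        pd_t S z + (\<Sum>j\<in>UNIV. V z $ j * pd_x j S z) = 0)"

(* The initial entropy is determined by \<rho>0 and p0 through the equation of state. *)
definition cauchy_solution ::
  "real \<Rightarrow> (real^'n \<Rightarrow> real) \<Rightarrow> (real^'n \<Rightarrow> real^'n) \<Rightarrow> (real^'n \<Rightarrow> real) \<Rightarrow> ((real^'n) \<times> real) set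
   \<Rightarrow> ((real^'n) \<times> real \<Rightarrow> real) \<Rightarrow> ((real^'n) \<times> real \<Rightarrow> real^'n)
   \<Rightarrow> ((real^'n) \<times> real \<Rightarrow> real) \<Rightarrow> ((real^'n) \<times> real \<Rightarrow> real) \<Rightarrow> bool" where
  "cauchy_solution \<gamma> \<rho>0 V0 p0 \<Omega> \<rho> V p S \<longleftrightarrow>
     euler_solution \<gamma> \<Omega> \<rho> V p S \<and>
     (\<forall>x. \<rho> (x, 0) = \<rho>0 x \<and> V (x, 0) = V0 x \<and> p (x, 0) = p0 x)"

definition continuable ::
  "real \<Rightarrow> ((real^'n) \<times> real) set \<Rightarrow> ((real^'n) \<times> real) set
   \<Rightarrow> ((real^'n) \<times> real \<Rightarrow> real) \<Rightarrow> ((real^'n) \<times> real \<Rightarrow> real^'n)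
   \<Rightarrow> ((real^'n) \<times> real \<Rightarrow> real) \<Rightarrow> ((real^'n) \<times> real \<Rightarrow> real) \<Rightarrow> bool" where
  "continuable \<gamma> \<Omega> \<Omega>' \<rho> V p S \<longleftrightarrow>
     (\<exists>\<rho>' V' p' S'. euler_solution \<gamma> \<Omega>' \<rho>' V' p' S' \<and>
        (\<forall>z\<in>\<Omega>. \<rho>' z = \<rho> z \<and> V' z = V z \<and> p' z = p z \<and> S' z = S z))"

(* Loss of smoothness within time T1 inside K. First conjunct: a classical solution cannot persist
   through time T1, not even if at the final time T1 smoothness is only required on K; in
   particular no classical solution exists on UNIV \<times> {0..T1} or on a longer time interval.
   Second conjunct: the breakdown takes place inside K, i.e. a classical solution that has reached
   the end T of its life span cannot be continued past T inside K either. *)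
definition loses_smoothness_within ::
  "real \<Rightarrow> (real^'n \<Rightarrow> real) \<Rightarrow> (real^'n \<Rightarrow> real^'n) \<Rightarrow> (real^'n \<Rightarrow> real) \<Rightarrow> real \<Rightarrow> (real^'n) set
   \<Rightarrow> bool" where
  "loses_smoothness_within \<gamma> \<rho>0 V0 p0 T1 K \<longleftrightarrow>
     (\<nexists>\<rho> V p S. cauchy_solution \<gamma> \<rho>0 V0 p0 (UNIV \<times> {0..<T1} \<union> K \<times> {T1}) \<rho> V p S) \<and>
     (\<forall>T>0. \<forall>\<rho> V p S.
        cauchy_solution \<gamma> \<rho>0 V0 p0 (UNIV \<times> {0..<T}) \<rho> V p S \<longrightarrow>
        (\<forall>T'>T. \<not> continuable \<gamma> (UNIV \<times> {0..<T}) (UNIV \<times> {0..<T'}) \<rho> V p S) \<longrightarrow>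
        (\<forall>T'>T. \<not> continuable \<gamma> (UNIV \<times> {0..<T}) (UNIV \<times> {0..<T} \<union> K \<times> {0..<T'}) \<rho> V p S))"

(* The arguments \<rho>, V, p are the state at a fixed time t, and r is the radius
   of the region of perturbation at that time. *)
definition energy ::
  "real \<Rightarrow> real \<Rightarrow> real \<Rightarrow> (real^'n \<Rightarrow> real) \<Rightarrow> (real^'n \<Rightarrow> real^'n) \<Rightarrow> (real^'n \<Rightarrow> real) \<Rightarrow> real" where
  "energy \<gamma> pbar r \<rho> V p =
     1/2 * (LINT x|lborel. \<rho> x * (norm (V x))\<^sup>2)
     + 1 / (\<gamma> - 1) * (LINT x:ball 0 r|lborel. p x - pbar)"

definition cutoff_B :: "real \<Rightarrow> real \<Rightarrow> real" where
  "cutoff_B R k = k / (R\<^sup>2 * (k - 1))"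

definition cutoff :: "real \<Rightarrow> real \<Rightarrow> real \<Rightarrow> real" where
  "cutoff R k r =
     (if r \<le> R - R / k then 1 - cutoff_B R k * r\<^sup>2
      else if r \<le> R then cutoff_B R k * (k - 1) * (r - R)\<^sup>2
      else 0)"

definition G_cutoff :: "real \<Rightarrow> real \<Rightarrow> (real^'n \<Rightarrow> real) \<Rightarrow> real" where
  "G_cutoff R k \<rho> = (LINT x|lborel. \<rho> x * cutoff R k (norm x))"

(* The integrand at the single point x = 0 is 0 by the convention for division. *)
definition G'_cutoff :: "real \<Rightarrow> real \<Rightarrow> (real^'n \<Rightarrow> real) \<Rightarrow> (real^'n \<Rightarrow> real^'n) \<Rightarrow> real" where
  "G'_cutoff R k \<rho> V =
     (LINT x|lborel. deriv (cutoff R k) (norm x) / norm x * (V x \<bullet> x) * \<rho> x)"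

end

theory Submission
  imports Defs
begin

text \<open>
Let \<open>\<sigma>\<close> be the sound speed of the background state. A classical solution that starts as a
perturbation of this state inside the ball of radius \<open>R0\<close> equals the background state outside the
ball of radius \<open>R0 + \<sigma> * t\<close> (\<open>domain_of_dependence\<close>, \<open>finite_speed\<close>). Hence up to time \<open>T2\<close> all
the motion takes place where \<open>norm x \<le> R - R / k\<close>, and there the cutoff is the polynomial
\<open>1 - B * (x \<bullet> x)\<close>. So the weighted mass \<open>G\<close> obeys the virial identity of a quadratic weight: its
second time derivative is \<open>- 2 * B\<close> times the integral of \<open>\<rho> * (norm V)\<^sup>2 + n * (p - pbar)\<close>. The
energy is conserved (\<open>energy_conserved\<close>) and \<open>p \<ge> 0\<close>; together they bound this integral below by
\<open>N\<close> (\<open>virial_coefficient_bound\<close>), and therefore \<open>G(t) \<le> G(0) + G'(0) * t - B * N * t\<^sup>2\<close>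
(\<open>virial_upper_bound\<close>).

The time \<open>T1\<close> is a zero of this parabola (\<open>discriminant_root\<close>). But \<open>G\<close> stays away from zero: in the
shell between the radii \<open>R - R / k\<close> and \<open>R\<close> the density is still the background density and the
cutoff is positive, so this shell alone contributes a fixed positive amount
(\<open>G_cutoff_lower_bound\<close>). Letting \<open>t\<close> tend to \<open>T1\<close> gives a contradiction, already for solutions
on the half-open time interval (\<open>no_solution_up_to\<close>).

The sharp propagation speed comes from comparing with a constant state. The difference between the
solution and the background satisfies the linear acoustic equations of the background, up to terms
that are bounded by the difference itself, because the first derivatives of the solution are bounded
on compact sets. For the acoustic equations the energy in a cone that shrinks with speed \<open>\<sigma>\<close> does
not grow, and Gronwall's inequality absorbs the lower order terms.

Finally, the breakdown happens inside the ball: the life span ends before the perturbation has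
reached its boundary, so a continuation inside the ball would be the background state near the
boundary, and could be continued by that state to the whole space
(\<open>continuable_if_continuable_inside\<close>).
\<close>

section \<open>Directional derivatives and continuously differentiable functions\<close>

text \<open>
Time and space derivatives are treated together as derivatives in a direction \<open>v\<close>, so that the
rules of calculus are proved once and then specialised to \<open>pd_t\<close> and \<open>pd_x\<close>.
\<close>

definition dirderiv :: "'a::real_normed_vector \<Rightarrow> ('a \<Rightarrow> real) \<Rightarrow> 'a \<Rightarrow> real" where
  "dirderiv v f z = frechet_derivative f (at z) v"

lemma pd_t_eq_dirderiv: "pd_t f = dirderiv (0, 1) f"
  by (simp add: fun_eq_iff pd_t_def dirderiv_def)

lemma pd_x_eq_dirderiv: "pd_x j f = dirderiv (axis j 1, 0) f"
  by (simp add: fun_eq_iff pd_x_def dirderiv_def)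

lemma dirderivI: "(f has_derivative f') (at z) \<Longrightarrow> dirderiv v f z = f' v"
  by (metis dirderiv_def frechet_derivative_at)

lemma dirderiv_works:
  "f differentiable (at z) \<Longrightarrow> (f has_derivative (\<lambda>v. dirderiv v f z)) (at z)"
  by (simp add: dirderiv_def frechet_derivative_works)

lemma dirderiv_const [simp]: "dirderiv v (\<lambda>z. c) z = 0"
  by (rule dirderivI) (rule has_derivative_const)

lemma dirderiv_add:
  "f differentiable (at z) \<Longrightarrow> g differentiable (at z) \<Longrightarrow>
   dirderiv v (\<lambda>z. f z + g z) z = dirderiv v f z + dirderiv v g z"
  by (rule dirderivI) (auto intro!: derivative_eq_intros dirderiv_works)

lemma dirderiv_diff:
  "f differentiable (at z) \<Longrightarrow> g differentiable (at z) \<Longrightarrow>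
   dirderiv v (\<lambda>z. f z - g z) z = dirderiv v f z - dirderiv v g z"
  by (rule dirderivI) (auto intro!: derivative_eq_intros dirderiv_works)

lemma dirderiv_mult:
  "f differentiable (at z) \<Longrightarrow> g differentiable (at z) \<Longrightarrow>
   dirderiv v (\<lambda>z. f z * g z) z = f z * dirderiv v g z + dirderiv v f z * g z"
  by (rule dirderivI) (auto intro!: derivative_eq_intros dirderiv_works)

lemma dirderiv_sum:
  "(\<And>i. i \<in> A \<Longrightarrow> f i differentiable (at z)) \<Longrightarrow>
   dirderiv v (\<lambda>z. \<Sum>i\<in>A. f i z) z = (\<Sum>i\<in>A. dirderiv v (f i) z)"
  by (rule dirderivI) (auto intro!: derivative_eq_intros dirderiv_works)

lemma dirderiv_compose:
  assumes "f differentiable (at z)" "(g has_real_derivative g') (at (f z))"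
  shows "dirderiv v (\<lambda>z. g (f z)) z = g' * dirderiv v f z"
  using has_derivative_compose[OF dirderiv_works[OF assms(1)]
      assms(2)[unfolded has_field_derivative_def]]
  by (rule dirderivI)

lemma dirderiv_linear: "bounded_linear f \<Longrightarrow> dirderiv v f z = f v"
  by (rule dirderivI) (rule bounded_linear_imp_has_derivative)

lemma dirderiv_cong_open:
  assumes "open W" "z \<in> W" "\<And>y. y \<in> W \<Longrightarrow> f y = g y"
  shows "dirderiv v f z = dirderiv v g z"
proof (cases "f differentiable (at z)")
  case True
  have "(g has_derivative (\<lambda>v. dirderiv v f z)) (at z)"
    using dirderiv_works[OF True] assms by (rule has_derivative_transform_within_open)
  then show ?thesis by (simp add: dirderivI)
next
  case False
  have "(f has_derivative f') (at z) \<longleftrightarrow> (g has_derivative f') (at z)" for f'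
    using assms has_derivative_transform_within_open[of f f' z UNIV W g]
      has_derivative_transform_within_open[of g f' z UNIV W f] by (metis)
  then show ?thesis by (simp add: dirderiv_def frechet_derivative_def)
qed

lemma differentiable_cong_open:
  assumes "f differentiable (at z)" "open W" "z \<in> W" "\<And>y. y \<in> W \<Longrightarrow> f y = g y"
  shows "g differentiable (at z)"
  using assms has_derivative_transform_within_open[of f _ z UNIV W g]
  unfolding differentiable_def by metis

text \<open>
In finite dimensions the continuity of every directional derivative amounts to the continuity of the
derivative in the operator norm; the pointwise form is easier to verify for products, sums and
compositions.
\<close>

definition C1_open :: "'a::real_normed_vector set \<Rightarrow> ('a \<Rightarrow> real) \<Rightarrow> bool" where
  "C1_open W f \<longleftrightarrow> (\<forall>z\<in>W. f differentiable (at z)) \<and> (\<forall>v. continuous_on W (dirderiv v f))"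

lemma C1_open_differentiable: "C1_open W f \<Longrightarrow> z \<in> W \<Longrightarrow> f differentiable (at z)"
  by (simp add: C1_open_def)

lemma C1_open_continuous_dirderiv: "C1_open W f \<Longrightarrow> continuous_on W (dirderiv v f)"
  by (simp add: C1_open_def)

lemma C1_open_continuous: "C1_open W f \<Longrightarrow> continuous_on W f"
  by (meson C1_open_def continuous_at_imp_continuous_on differentiable_imp_continuous_within)

lemma C1_open_subset: "C1_open W f \<Longrightarrow> W' \<subseteq> W \<Longrightarrow> C1_open W' f"
  by (auto simp: C1_open_def intro: continuous_on_subset)

lemma C1_open_const: "C1_open W (\<lambda>z. c)"
  by (auto simp: C1_open_def dirderiv_const[abs_def])

lemma C1_open_linear: "bounded_linear f \<Longrightarrow> C1_open W f"
  by (auto simp: C1_open_def dirderiv_linear bounded_linear_imp_differentiable cong: continuous_on_cong)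

lemma C1_open_add: "C1_open W f \<Longrightarrow> C1_open W g \<Longrightarrow> C1_open W (\<lambda>z. f z + g z)"
  unfolding C1_open_def
  by (auto simp: dirderiv_add intro!: continuous_on_add cong: continuous_on_cong)

lemma C1_open_diff: "C1_open W f \<Longrightarrow> C1_open W g \<Longrightarrow> C1_open W (\<lambda>z. f z - g z)"
  unfolding C1_open_def
  by (auto simp: dirderiv_diff intro!: continuous_on_diff cong: continuous_on_cong)

lemma C1_open_mult:
  assumes "C1_open W f" "C1_open W g"
  shows "C1_open W (\<lambda>z. f z * g z)"
  using assms C1_open_continuous[OF assms(1)] C1_open_continuous[OF assms(2)]
  unfolding C1_open_def
  by (auto simp: dirderiv_mult intro!: continuous_intros cong: continuous_on_cong)

lemma differentiable_sum_any:
  "(\<And>i. i \<in> A \<Longrightarrow> f i differentiable (at z)) \<Longrightarrow>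
   (\<lambda>z. \<Sum>i\<in>A. (f i z :: real)) differentiable (at z)"
  by (cases "finite A") auto

lemma C1_open_sum:
  "(\<And>i. i \<in> A \<Longrightarrow> C1_open W (f i)) \<Longrightarrow> C1_open W (\<lambda>z. \<Sum>i\<in>A. f i z)"
  unfolding C1_open_def
  by (auto simp: dirderiv_sum intro!: continuous_intros intro: differentiable_sum_any cong: continuous_on_cong)

lemma C1_open_compose:
  assumes f: "C1_open W f" and fS: "\<And>z. z \<in> W \<Longrightarrow> f z \<in> S"
    and g: "\<And>s. s \<in> S \<Longrightarrow> (g has_real_derivative g' s) (at s)" and g': "continuous_on S g'"
  shows "C1_open W (\<lambda>z. g (f z))"
  unfolding C1_open_def
proof (intro conjI ballI allI)
  fix z assume z: "z \<in> W"
  show "(\<lambda>z. g (f z)) differentiable (at z)"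
    using has_derivative_compose[OF dirderiv_works[OF C1_open_differentiable[OF f z]]
        g[OF fS[OF z], unfolded has_field_derivative_def]] by (rule differentiableI)
next
  fix v
  have "continuous_on W (\<lambda>z. g' (f z) * dirderiv v f z)"
    by (intro continuous_intros continuous_on_compose2[OF g' C1_open_continuous[OF f]]
        C1_open_continuous_dirderiv[OF f]) (use fS in auto)
  then show "continuous_on W (dirderiv v (\<lambda>z. g (f z)))"
    by (rule continuous_on_cong[THEN iffD1, rotated 2])
      (use dirderiv_compose[OF C1_open_differentiable[OF f] g[OF fS]] in auto)
qed

lemmas C1_open_intros = C1_open_const C1_open_add C1_open_diff C1_open_mult C1_open_sum

lemma C1_open_cong:
  assumes "C1_open W f" "open W" "\<And>z. z \<in> W \<Longrightarrow> f z = g z"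
  shows "C1_open W g"
  unfolding C1_open_def
proof (intro conjI ballI allI)
  show "g differentiable (at z)" if "z \<in> W" for z
    by (rule differentiable_cong_open[OF C1_open_differentiable[OF assms(1) that] assms(2) that assms(3)])
  show "continuous_on W (dirderiv v g)" for v
    using C1_open_continuous_dirderiv[OF assms(1), of v] dirderiv_cong_open[OF assms(2) _ assms(3)]
    by (auto cong: continuous_on_cong)
qed

lemma C1_open_Un:
  "C1_open W f \<Longrightarrow> C1_open W' f \<Longrightarrow> open W \<Longrightarrow> open W' \<Longrightarrow> C1_open (W \<union> W') f"
  by (auto simp: C1_open_def intro!: continuous_on_open_Un)

text \<open>
This makes functions that are only defined over \<open>X\<close> accessible to the integral identities on the
whole space: if the support stays in a closed subset of \<open>X\<close>, the extension by zero is locally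
either the given function or zero.
\<close>

lemma C1_open_extend_zero:
  fixes g :: "'a::real_normed_vector \<times> real \<Rightarrow> real"
  assumes g: "C1_open (X \<times> I) g" and "open X" "open I" "closed K" "K \<subseteq> X"
    and zero: "\<And>x t. x \<in> X - K \<Longrightarrow> t \<in> I \<Longrightarrow> g (x, t) = 0"
  shows "C1_open (UNIV \<times> I) (\<lambda>z. if fst z \<in> X then g z else 0)" (is "C1_open _ ?h")
proof -
  have o: "open (X \<times> I)" "open ((- K) \<times> I)" using assms by (auto intro: open_Times)
  have "C1_open (X \<times> I) ?h"
    by (rule C1_open_cong[OF g o(1)]) auto
  moreover have "C1_open ((- K) \<times> I) ?h"
    by (rule C1_open_cong[OF C1_open_const[of _ 0] o(2)]) (use zero in auto)
  ultimately have "C1_open (X \<times> I \<union> (- K) \<times> I) ?h" using o by (rule C1_open_Un)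
  then show ?thesis by (rule C1_open_subset) (use \<open>K \<subseteq> X\<close> in auto)
qed

lemma continuous_on_extend_zero:
  fixes u :: "'a::topological_space \<times> 'b::topological_space \<Rightarrow> real"
  assumes u: "continuous_on (X \<times> J) u" and "open X" "closed C" "C \<subseteq> X"
    and zero: "\<And>x t. x \<in> X - C \<Longrightarrow> t \<in> J \<Longrightarrow> u (x, t) = 0"
  shows "continuous_on (UNIV \<times> J) (\<lambda>z. if fst z \<in> X then u z else 0)" (is "continuous_on _ ?w")
proof -
  have 1: "openin (top_of_set (X \<times> J \<union> (- C) \<times> J)) (X \<times> J)"
    unfolding openin_open
    by (rule exI[of _ "X \<times> UNIV"]) (use assms in \<open>auto intro!: open_Times\<close>)
  have 2: "openin (top_of_set (X \<times> J \<union> (- C) \<times> J)) ((- C) \<times> J)"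
    unfolding openin_open
    by (rule exI[of _ "(- C) \<times> UNIV"]) (use assms in \<open>auto intro!: open_Times\<close>)
  have "continuous_on (X \<times> J) ?w"
    by (rule continuous_on_cong[THEN iffD1, rotated 2, OF u]) auto
  moreover have "continuous_on ((- C) \<times> J) ?w"
    by (rule continuous_on_cong[THEN iffD1, rotated 2, OF continuous_on_const[of _ 0]])
      (use zero in auto)
  ultimately have "continuous_on (X \<times> J \<union> (- C) \<times> J) ?w"
    by (rule continuous_on_Un_local_open[OF 1 2])
  moreover have "X \<times> J \<union> (- C) \<times> J = UNIV \<times> J" using \<open>C \<subseteq> X\<close> by auto
  ultimately show ?thesis by simp
qed

lemma C1_on_subset: "C1_on U f \<Longrightarrow> U' \<subseteq> U \<Longrightarrow> C1_on U' f"
  unfolding C1_on_def by (meson continuous_on_subset has_derivative_subset in_mono)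

lemma C1_on_continuous: "C1_on U f \<Longrightarrow> continuous_on U f"
  unfolding C1_on_def continuous_on_eq_continuous_within by (meson has_derivative_continuous)

lemma C1_on_bounded_linear:
  assumes "C1_on U f" "bounded_linear h"
  shows "C1_on U (\<lambda>z. h (f z))"
proof -
  from assms(1) obtain f' where f': "\<And>z. z \<in> U \<Longrightarrow> (f has_derivative blinfun_apply (f' z)) (at z within U)"
    and cont: "continuous_on U f'" unfolding C1_on_def by blast
  let ?f' = "\<lambda>z. Blinfun h o\<^sub>L f' z"
  have "((\<lambda>z. h (f z)) has_derivative blinfun_apply (?f' z)) (at z within U)" if "z \<in> U" for z
    using bounded_linear.has_derivative[OF assms(2) f'[OF that]]
    by (simp add: o_def bounded_linear_Blinfun_apply[OF assms(2)] blinfun_compose.rep_eq)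
  moreover have "continuous_on U ?f'"
    by (intro continuous_intros cont)
  ultimately show ?thesis unfolding C1_on_def by (intro exI[of _ ?f']) blast
qed

lemma C1_on_component: "C1_on U V \<Longrightarrow> C1_on U (\<lambda>z. V z $ i)"
  by (rule C1_on_bounded_linear[where h = "\<lambda>x. x $ i"]) (auto intro: bounded_linear_vec_nth)

lemma C1_on_interior:
  fixes f :: "'a::real_normed_vector \<Rightarrow> real"
  assumes "C1_on U f"
  obtains f' where "\<And>z v. z \<in> interior U \<Longrightarrow> dirderiv v f z = blinfun_apply (f' z) v"
    "\<And>z. z \<in> interior U \<Longrightarrow> f differentiable (at z)" "continuous_on U f'"
proof -
  from assms obtain f' where f': "\<And>z. z \<in> U \<Longrightarrow> (f has_derivative blinfun_apply (f' z)) (at z within U)"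
    and cont: "continuous_on U f'" unfolding C1_on_def by blast
  have hd: "(f has_derivative blinfun_apply (f' z)) (at z)" if "z \<in> interior U" for z
    using f'[OF subsetD[OF interior_subset that]] unfolding at_within_interior[OF that] .
  then show thesis
    by (intro that[of f'] dirderivI differentiableI cont) (use hd in simp_all)
qed

lemma C1_on_imp_C1_open:
  fixes f :: "'a::real_normed_vector \<Rightarrow> real"
  assumes "C1_on U f"
  shows "C1_open (interior U) f"
proof -
  obtain f' where f': "\<And>z v. z \<in> interior U \<Longrightarrow> dirderiv v f z = blinfun_apply (f' z) v"
    "\<And>z. z \<in> interior U \<Longrightarrow> f differentiable (at z)" "continuous_on U f'"
    using C1_on_interior[OF assms] by metis
  have "continuous_on (interior U) (\<lambda>z. blinfun_apply (f' z) v)" for v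
    by (intro continuous_intros continuous_on_subset[OF f'(3) interior_subset])
  then show ?thesis using f' by (auto simp: C1_open_def cong: continuous_on_cong)
qed

text \<open>
The derivative extends continuously up to the boundary points of \<open>U\<close>, so it is bounded on compact
subsets that touch the boundary, for instance on sets containing points of the initial time.
\<close>

lemma C1_on_dirderiv_bounded:
  fixes f :: "'a::real_normed_vector \<Rightarrow> real"
  assumes "C1_on U f" "compact K" "K \<subseteq> U"
  shows "\<exists>M\<ge>0. \<forall>z\<in>K \<inter> interior U. \<forall>v. norm v = 1 \<longrightarrow> \<bar>dirderiv v f z\<bar> \<le> M"
proof -
  obtain f' where f': "\<And>z v. z \<in> interior U \<Longrightarrow> dirderiv v f z = blinfun_apply (f' z) v"
    and cont: "continuous_on U f'"
    using C1_on_interior[OF assms(1)] by metis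
  have "compact (f' ` K)"
    by (intro compact_continuous_image continuous_on_subset[OF cont] assms)
  then obtain M where M: "\<And>z. z \<in> K \<Longrightarrow> norm (f' z) \<le> M"
    using compact_imp_bounded bounded_iff by (metis imageI)
  have "\<bar>dirderiv v f z\<bar> \<le> \<bar>M\<bar>" if "z \<in> K \<inter> interior U" "norm v = 1" for z v
  proof -
    have "\<bar>dirderiv v f z\<bar> \<le> norm (f' z) * norm v"
      using norm_blinfun[of "f' z" v] that by (simp add: f')
    also have "\<dots> \<le> \<bar>M\<bar>" using M[of z] that by auto
    finally show ?thesis .
  qed
  then show ?thesis by (intro exI[of _ "\<bar>M\<bar>"]) simp
qed

lemmas pd_t_rules =
  dirderiv_const[where v = "(0 :: real^'n::finite, 1 :: real)", folded pd_t_eq_dirderiv]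
  dirderiv_add[where v = "(0 :: real^'n::finite, 1 :: real)", folded pd_t_eq_dirderiv]
  dirderiv_diff[where v = "(0 :: real^'n::finite, 1 :: real)", folded pd_t_eq_dirderiv]
  dirderiv_mult[where v = "(0 :: real^'n::finite, 1 :: real)", folded pd_t_eq_dirderiv]
  dirderiv_sum[where v = "(0 :: real^'n::finite, 1 :: real)", folded pd_t_eq_dirderiv]

lemmas pd_x_rules =
  dirderiv_const[where v = "(axis j 1 :: real^'n::finite, 0 :: real)" for j :: "'n::finite", folded pd_x_eq_dirderiv]
  dirderiv_add[where v = "(axis j 1 :: real^'n::finite, 0 :: real)" for j :: "'n::finite", folded pd_x_eq_dirderiv]
  dirderiv_diff[where v = "(axis j 1 :: real^'n::finite, 0 :: real)" for j :: "'n::finite", folded pd_x_eq_dirderiv]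
  dirderiv_mult[where v = "(axis j 1 :: real^'n::finite, 0 :: real)" for j :: "'n::finite", folded pd_x_eq_dirderiv]
  dirderiv_sum[where v = "(axis j 1 :: real^'n::finite, 0 :: real)" for j :: "'n::finite", folded pd_x_eq_dirderiv]

lemma pd_t_fst: "pd_t (\<lambda>z. fst z $ i) z = 0"
  unfolding pd_t_eq_dirderiv
  by (subst dirderiv_linear)
    (auto intro!: bounded_linear_compose[OF bounded_linear_vec_nth bounded_linear_fst])

lemma pd_x_fst: "pd_x j (\<lambda>z. fst z $ i) z = (if i = j then 1 else 0)"
  unfolding pd_x_eq_dirderiv
  by (subst dirderiv_linear)
    (auto simp: axis_def intro!: bounded_linear_compose[OF bounded_linear_vec_nth bounded_linear_fst])

lemma C1_open_fst: "C1_open W (\<lambda>z. fst z $ i)"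
  by (intro C1_open_linear bounded_linear_compose[OF bounded_linear_vec_nth bounded_linear_fst])

lemma norm_axis_Pair: "norm (axis j (1::real), 0::real) = 1"
  by (simp add: norm_Pair)

section \<open>Integrals of compactly supported functions\<close>

lemma integrable_compact_support:
  fixes f :: "'a::euclidean_space \<Rightarrow> real"
  assumes f: "continuous_on UNIV f" and supp: "\<And>x. x \<notin> cball c r \<Longrightarrow> f x = 0"
  shows "integrable lborel f"
proof -
  have "set_integrable lborel (cball c r) f"
    unfolding set_integrable_def
    by (rule borel_integrable_compact) (auto intro: continuous_on_subset[OF f])
  moreover have "(\<lambda>x. indicator (cball c r) x *\<^sub>R f x) = f"
    using supp by (auto simp: indicator_def fun_eq_iff)
  ultimately show ?thesis by (simp add: set_integrable_def)
qed

lemma integral_compact_support: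
  fixes f :: "'a::euclidean_space \<Rightarrow> real"
  assumes f: "continuous_on UNIV f" and supp: "\<And>x. x \<notin> cball c r \<Longrightarrow> f x = 0"
    and sub: "cball c r \<subseteq> cbox a b"
  shows "integral (cbox a b) f = (LINT x|lborel. f x)"
proof -
  have "(\<lambda>x. if x \<in> cbox a b then f x else 0) = f"
  proof
    fix x
    have "f x = 0" if "x \<notin> cbox a b"
      using supp[of x] sub that by blast
    then show "(if x \<in> cbox a b then f x else 0) = f x"
      by presburger
  qed
  then have "integral (cbox a b) f = integral UNIV f"
    using integral_restrict_UNIV[of "cbox a b" f] by simp
  also have "\<dots> = (LINT x|lborel. f x)"
    using integrable_compact_support[OF f, of c r] supp by (simp add: integral_lborel)
  finally show ?thesis .
qed

lemma continuous_on_slice: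
  "continuous_on (A \<times> I) f \<Longrightarrow> t \<in> I \<Longrightarrow> continuous_on A (\<lambda>x. f (x, t))"
  by (rule continuous_on_compose2[where f = "\<lambda>x. (x, t)"]) (auto intro!: continuous_intros)

lemma continuous_on_swap_pair:
  assumes "continuous_on (A \<times> I) f" "B \<subseteq> A" "J \<subseteq> I"
  shows "continuous_on (J \<times> B) (\<lambda>(t, x). f (x, t))"
proof -
  have "continuous_on (J \<times> B) (\<lambda>z. f (snd z, fst z))"
    by (rule continuous_on_compose2[OF assms(1), where f = "\<lambda>z. (snd z, fst z)"])
      (use assms in \<open>auto intro!: continuous_intros\<close>)
  then show ?thesis by (simp add: split_beta)
qed

lemma cball_subset_some_cbox:
  fixes c :: "'a::euclidean_space"
  obtains a where "cball c r \<subseteq> cbox (-a) a"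
  using bounded_subset_cbox_symmetric[OF bounded_cball] by blast

lemma continuous_on_integral_compact_support:
  fixes u :: "'a::euclidean_space \<times> real \<Rightarrow> real"
  assumes u: "continuous_on (UNIV \<times> I) u" and supp: "\<And>x t. t \<in> I \<Longrightarrow> x \<notin> cball c r \<Longrightarrow> u (x, t) = 0"
  shows "continuous_on I (\<lambda>t. LINT x|lborel. u (x, t))"
proof -
  obtain a where a: "cball c r \<subseteq> cbox (-a) a" using cball_subset_some_cbox .
  have "continuous_on I (\<lambda>t. integral (cbox (-a) a) (\<lambda>x. u (x, t)))"
    by (rule integral_continuous_on_param) (rule continuous_on_swap_pair[OF u], auto)
  then show ?thesis
    by (rule continuous_on_cong[THEN iffD1, rotated 2])
      (use integral_compact_support[OF continuous_on_slice[OF u] supp a] in auto)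
qed

lemma differentiable_under_integral:
  fixes u :: "'a::euclidean_space \<times> real \<Rightarrow> real"
  assumes I: "open I" "t \<in> I" and u: "C1_open (UNIV \<times> I) u"
    and supp: "\<And>x t. t \<in> I \<Longrightarrow> x \<notin> cball c r \<Longrightarrow> u (x, t) = 0"
  shows "((\<lambda>t. LINT x|lborel. u (x, t)) has_real_derivative
          (LINT x|lborel. dirderiv (0, 1) u (x, t))) (at t)"
    and "integrable lborel (\<lambda>x. dirderiv v u (x, t))"
proof -
  obtain a where a: "cball c r \<subseteq> cbox (-a) a" using cball_subset_some_cbox .
  have supp': "dirderiv v u (x, s) = 0" if "s \<in> I" "x \<notin> cball c r" for x s v
  proof -
    have "dirderiv v u (x, s) = dirderiv v (\<lambda>z. 0) (x, s)"
      by (rule dirderiv_cong_open[of "(- cball c r) \<times> I"])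
        (use that I supp in \<open>auto intro!: open_Times\<close>)
    then show ?thesis by simp
  qed
  have cont': "continuous_on UNIV (\<lambda>x. dirderiv v u (x, s))" if "s \<in> I" for s v
    using continuous_on_slice[OF C1_open_continuous_dirderiv[OF u] that] .
  show "integrable lborel (\<lambda>x. dirderiv v u (x, t))"
    by (rule integrable_compact_support[OF cont'[OF I(2)] supp'[OF I(2)]])
  obtain e where e: "e > 0" "ball t e \<subseteq> I"
    using I open_contains_ball by blast
  have dw: "((\<lambda>s. u (x, s)) has_real_derivative dirderiv (0, 1) u (x, s)) (at s within ball t e)"
    if "s \<in> ball t e" for s x
  proof -
    have diff: "u differentiable (at (x, s))"
      using that e by (intro C1_open_differentiable[OF u]) auto
    have "((\<lambda>s. (x, s)) has_derivative (\<lambda>h. (0, h))) (at s)"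
      by (auto intro!: derivative_eq_intros)
    from has_derivative_compose[OF this dirderiv_works[OF diff]]
    have *: "((\<lambda>s. u (x, s)) has_derivative (\<lambda>h. dirderiv (0, h) u (x, s))) (at s)" .
    have "dirderiv (0, h) u (x, s) = dirderiv (0, 1) u (x, s) * h" for h
      using linear_cmul[OF has_derivative_linear[OF dirderiv_works[OF diff]], of h "(0, 1)"]
      by (simp add: mult.commute)
    then have "(\<lambda>h. dirderiv (0, h) u (x, s)) = (*) (dirderiv (0, 1) u (x, s))"
      by (rule ext)
    with * show ?thesis
      unfolding has_field_derivative_def by (metis has_derivative_at_withinI)
  qed
  have "((\<lambda>s. integral (cbox (-a) a) (\<lambda>x. u (x, s))) has_real_derivative
      integral (cbox (-a) a) (\<lambda>x. dirderiv (0, 1) u (x, t))) (at t within ball t e)"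
  proof (rule leibniz_rule_field_derivative[where fx = "\<lambda>s x. dirderiv (0, 1) u (x, s)"])
    show "(\<lambda>x. u (x, s)) integrable_on cbox (-a) a" if "s \<in> ball t e" for s
      using that e by (intro integrable_continuous continuous_on_subset[OF
          continuous_on_slice[OF C1_open_continuous[OF u]]]) auto
    show "continuous_on (ball t e \<times> cbox (-a) a) (\<lambda>(s, x). dirderiv (0, 1) u (x, s))"
      by (rule continuous_on_swap_pair[OF C1_open_continuous_dirderiv[OF u]]) (use e in auto)
  qed (use e in \<open>simp_all add: dw\<close>)
  then have "((\<lambda>s. integral (cbox (-a) a) (\<lambda>x. u (x, s))) has_real_derivative
      (LINT x|lborel. dirderiv (0, 1) u (x, t))) (at t)"
    unfolding at_within_open[OF centre_in_ball[THEN iffD2, OF e(1)] open_ball]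
    by (subst integral_compact_support[symmetric, where a = "-a" and b = a and c = c and r = r])
      (use cont'[OF I(2)] supp'[OF I(2)] a in auto)
  then show "((\<lambda>t. LINT x|lborel. u (x, t)) has_real_derivative
          (LINT x|lborel. dirderiv (0, 1) u (x, t))) (at t)"
    by (rule has_field_derivative_transform_within_open[where S = "ball t e"])
      (use integral_compact_support[OF continuous_on_slice[OF C1_open_continuous[OF u]] supp a] e in \<open>auto simp del: mem_ball\<close>)
qed

text \<open>
The divergence theorem for compact support, in the form in which it is needed. The integral of the
translate \<open>\<lambda>x. g (x + s *\<^sub>R v)\<close> is independent of \<open>s\<close>; its derivative at \<open>s = 0\<close>, computed under
the integral sign, is the integral of the derivative of \<open>g\<close>.
\<close>

lemma integral_dirderiv_eq_0:
  fixes g :: "'a::euclidean_space \<Rightarrow> real"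
  assumes g: "C1_open UNIV g" and supp: "\<And>x. x \<notin> cball c r \<Longrightarrow> g x = 0"
  shows "(LINT x|lborel. dirderiv v g x) = 0"
proof -
  \<comment> \<open>The parameter \<open>s\<close> takes the place of the time variable.\<close>
  let ?w = "\<lambda>z. g (fst z + snd z *\<^sub>R v)"
  have hd: "(?w has_derivative (\<lambda>h. dirderiv (fst h + snd h *\<^sub>R v) g (fst z + snd z *\<^sub>R v))) (at z)" for z
    by (rule has_derivative_compose[OF _ dirderiv_works[OF C1_open_differentiable[OF g]]])
      (auto intro!: derivative_eq_intros)
  have dd: "dirderiv h ?w z = dirderiv (fst h + snd h *\<^sub>R v) g (fst z + snd z *\<^sub>R v)" for h z
    by (rule dirderivI[OF hd])
  have w: "C1_open (UNIV \<times> {-1<..<1}) ?w"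
    unfolding C1_open_def
  proof (intro conjI ballI allI)
    show "?w differentiable (at z)" for z using hd by (rule differentiableI)
    show "continuous_on (UNIV \<times> {-1<..<1}) (dirderiv h ?w)" for h
      unfolding dd[abs_def]
      by (rule continuous_on_compose2[OF C1_open_continuous_dirderiv[OF g]]) (auto intro!: continuous_intros)
  qed
  have supp': "?w (x, s) = 0" if "s \<in> {-1<..<1}" "x \<notin> cball c (r + norm v)" for x s
  proof -
    have "norm (s *\<^sub>R v) \<le> norm v" using that by (auto simp: mult_left_le_one_le)
    moreover have "norm (c - x) \<le> norm (c - (x + s *\<^sub>R v)) + norm (s *\<^sub>R v)"
      using norm_triangle_ineq[of "c - (x + s *\<^sub>R v)" "s *\<^sub>R v"] by (simp add: algebra_simps)
    ultimately show ?thesis using that by (intro supp) (simp_all add: dist_norm)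
  qed
  have "((\<lambda>s. LINT x|lborel. ?w (x, s)) has_real_derivative
      (LINT x|lborel. dirderiv (0, 1) ?w (x, 0))) (at 0)"
    by (rule differentiable_under_integral(1)[OF _ _ w supp']) auto
  moreover have "(LINT x|lborel. ?w (x, s)) = (LINT x|lborel. g x)" for s
  proof -
    have [measurable]: "g \<in> borel_measurable borel"
      using C1_open_continuous[OF g] by (rule borel_measurable_continuous_onI)
    have "(LINT x|lborel. g x) = (LINT x|distr lborel borel ((+) (s *\<^sub>R v)). g x)"
      by (subst lborel_distr_plus) simp
    also have "\<dots> = (LINT x|lborel. g (s *\<^sub>R v + x))"
      by (subst integral_distr) auto
    finally show ?thesis by (simp add: add.commute)
  qed
  ultimately show ?thesis
    using DERIV_unique[OF _ DERIV_const] by (simp add: dd)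
qed

text \<open>
The flux \<open>F\<close> is arbitrary, since its divergence integrates to zero. It is chosen in each application
so that the integrand on the right simplifies by the equations.
\<close>

lemma balance_law:
  fixes u :: "(real^'n) \<times> real \<Rightarrow> real" and F :: "'n \<Rightarrow> (real^'n) \<times> real \<Rightarrow> real"
  assumes I: "open I" "t \<in> I" and u: "C1_open (UNIV \<times> I) u" and F: "\<And>j. C1_open (UNIV \<times> I) (F j)"
    and supp: "\<And>x t. t \<in> I \<Longrightarrow> x \<notin> cball c r \<Longrightarrow> u (x, t) = 0"
    and suppF: "\<And>x t j. t \<in> I \<Longrightarrow> x \<notin> cball c r \<Longrightarrow> F j (x, t) = 0"
  shows "((\<lambda>t. LINT x|lborel. u (x, t)) has_real_derivative
          (LINT x|lborel. pd_t u (x, t) + (\<Sum>j\<in>UNIV. pd_x j (F j) (x, t)))) (at t)"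
    and "integrable lborel (\<lambda>x. pd_t u (x, t) + (\<Sum>j\<in>UNIV. pd_x j (F j) (x, t)))"
proof -
  have 0: "(LINT x|lborel. dirderiv (v, 0) (F j) (x, t)) = 0" for j v
  proof -
    have hd: "((\<lambda>x. F j (x, t)) has_derivative (\<lambda>h. dirderiv (h, 0) (F j) (x, t))) (at x)" for x
      by (rule has_derivative_compose[OF _ dirderiv_works[OF C1_open_differentiable[OF F]]])
       (use I in \<open>auto intro!: derivative_eq_intros\<close>)
    have dd: "dirderiv h (\<lambda>x. F j (x, t)) x = dirderiv (h, 0) (F j) (x, t)" for h x
      by (rule dirderivI[OF hd])
    have "C1_open UNIV (\<lambda>x. F j (x, t))"
      unfolding C1_open_def dd[abs_def]
      using continuous_on_slice[OF C1_open_continuous_dirderiv[OF F] I(2)] differentiableI[OF hd]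
      by blast
    then have "(LINT x|lborel. dirderiv v (\<lambda>x. F j (x, t)) x) = 0"
      by (rule integral_dirderiv_eq_0) (rule suppF[OF I(2)])
    then show ?thesis by (simp add: dd)
  qed
  note D = differentiable_under_integral[OF I u supp]
  note DF = differentiable_under_integral(2)[OF I F suppF]
  show "integrable lborel (\<lambda>x. pd_t u (x, t) + (\<Sum>j\<in>UNIV. pd_x j (F j) (x, t)))"
    unfolding pd_t_eq_dirderiv pd_x_eq_dirderiv using D(2) DF by simp
  have "(LINT x|lborel. pd_t u (x, t) + (\<Sum>j\<in>UNIV. pd_x j (F j) (x, t))) =
      (LINT x|lborel. dirderiv (0, 1) u (x, t))"
    unfolding pd_t_eq_dirderiv pd_x_eq_dirderiv
    by (subst Bochner_Integration.integral_add) (use D(2) DF 0 in auto)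
  then show "((\<lambda>t. LINT x|lborel. u (x, t)) has_real_derivative
          (LINT x|lborel. pd_t u (x, t) + (\<Sum>j\<in>UNIV. pd_x j (F j) (x, t)))) (at t)"
    using D(1) by simp
qed

text \<open>
A continuous nonnegative function with zero integral over a box vanishes on the box; the box is taken
so large that it contains both the support and the point \<open>x\<close>.
\<close>

lemma integral_compact_support_eq_0D:
  fixes f :: "'a::euclidean_space \<Rightarrow> real"
  assumes f: "continuous_on UNIV f" and supp: "\<And>x. x \<notin> cball c r \<Longrightarrow> f x = 0"
    and nonneg: "\<And>x. f x \<ge> 0" and int: "(LINT x|lborel. f x) = 0"
  shows "f x = 0"
proof -
  define s where "s = max r 0 + dist c x + 1"
  obtain a where a: "cball c s \<subseteq> cbox (-a) a" using cball_subset_some_cbox .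
  have "ball c s \<subseteq> box (-a) a"
    using interior_mono[OF a] by (simp add: interior_cbox)
  moreover have "x \<in> ball c s" by (simp add: s_def)
  ultimately have ne: "box (-a) a \<noteq> {}" "x \<in> cbox (-a) a" using box_subset_cbox by blast+
  have "r \<le> s" using zero_le_dist[of c x] max.cobounded1[of r 0] unfolding s_def by linarith
  then have "f y = 0" if "y \<notin> cball c s" for y using that subset_cball[of r s c] by (intro supp) blast
  then have "integral (cbox (-a) a) f = 0"
    using integral_compact_support[OF f _ a] int by simp
  then show ?thesis
    using integral_cbox_eq_0_iff[OF continuous_on_subset[OF f subset_UNIV] ne(1)] nonneg ne(2) by simp
qed

section \<open>The Euler equations in nonconservative form\<close>

text \<open>
A classical solution on an arbitrary domain. Away from the interior of the domain no equations are
available, so all differential identities below are stated at interior points.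
\<close>

locale euler_flow =
  fixes \<gamma> :: real and \<Omega> :: "((real^'n) \<times> real) set" and \<rho> :: "(real^'n) \<times> real \<Rightarrow> real"
    and V :: "(real^'n) \<times> real \<Rightarrow> real^'n" and p S :: "(real^'n) \<times> real \<Rightarrow> real"
  assumes solution: "euler_solution \<gamma> \<Omega> \<rho> V p S" and gamma: "\<gamma> > 1"
begin

lemma C1: "C1_on \<Omega> \<rho>" "C1_on \<Omega> p" "C1_on \<Omega> S" "C1_on \<Omega> (\<lambda>z. V z $ i)"
  using solution C1_on_component by (auto simp: euler_solution_def)

lemma rho_nonneg: "z \<in> \<Omega> \<Longrightarrow> \<rho> z \<ge> 0" and p_eq: "z \<in> \<Omega> \<Longrightarrow> p z = exp (S z) * \<rho> z powr \<gamma>"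
  using solution by (auto simp: euler_solution_def)

lemma p_nonneg: "z \<in> \<Omega> \<Longrightarrow> p z \<ge> 0"
  by (simp add: p_eq)

text \<open>
In finite dimensions the continuity of every directional derivative amounts to the continuity of the
derivative in the operator norm; the pointwise form is easier to verify for products, sums and
compositions.
\<close>

lemmas C1_open = C1[THEN C1_on_imp_C1_open]

lemmas differentiable = C1_open[THEN C1_open_differentiable]

lemma mass_equation:
  assumes "z \<in> interior \<Omega>"
  shows "pd_t \<rho> z + (\<Sum>j\<in>UNIV. V z $ j * pd_x j \<rho> z) + \<rho> z * (\<Sum>j\<in>UNIV. pd_x j (\<lambda>y. V y $ j) z) = 0"
proof -
  have "pd_x j (\<lambda>y. \<rho> y * V y $ j) z = V z $ j * pd_x j \<rho> z + \<rho> z * pd_x j (\<lambda>y. V y $ j) z" for j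
    using differentiable[OF assms] by (simp add: pd_x_rules mult.commute)
  moreover have "pd_t \<rho> z + (\<Sum>j\<in>UNIV. pd_x j (\<lambda>y. \<rho> y * V y $ j) z) = 0"
    using solution assms by (auto simp: euler_solution_def)
  ultimately show ?thesis
    by (simp add: sum.distrib sum_distrib_left)
qed

text \<open>
The conservative momentum equation minus the velocity times the mass equation.
\<close>

lemma momentum_equation:
  assumes "z \<in> interior \<Omega>"
  shows "\<rho> z * pd_t (\<lambda>y. V y $ i) z + \<rho> z * (\<Sum>j\<in>UNIV. V z $ j * pd_x j (\<lambda>y. V y $ i) z) + pd_x i p z = 0"
proof -
  note d = differentiable[OF assms]
  have 1: "pd_t (\<lambda>y. \<rho> y * V y $ i) z = \<rho> z * pd_t (\<lambda>y. V y $ i) z + V z $ i * pd_t \<rho> z"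
    using d by (simp add: pd_t_rules mult.commute)
  have 2: "pd_x j (\<lambda>y. \<rho> y * V y $ i * V y $ j) z = \<rho> z * (V z $ j * pd_x j (\<lambda>y. V y $ i) z)
     + V z $ i * (V z $ j * pd_x j \<rho> z + \<rho> z * pd_x j (\<lambda>y. V y $ j) z)" for j
    using d by (simp add: pd_x_rules algebra_simps)
  have 3: "pd_t (\<lambda>y. \<rho> y * V y $ i) z + (\<Sum>j\<in>UNIV. pd_x j (\<lambda>y. \<rho> y * V y $ i * V y $ j) z)
      + pd_x i p z = 0"
    using solution assms by (auto simp: euler_solution_def)
  have 4: "(\<Sum>j\<in>UNIV. pd_x j (\<lambda>y. \<rho> y * V y $ i * V y $ j) z) =
      \<rho> z * (\<Sum>j\<in>UNIV. V z $ j * pd_x j (\<lambda>y. V y $ i) z)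
      + V z $ i * ((\<Sum>j\<in>UNIV. V z $ j * pd_x j \<rho> z) + \<rho> z * (\<Sum>j\<in>UNIV. pd_x j (\<lambda>y. V y $ j) z))"
    unfolding 2 by (simp add: sum.distrib sum_distrib_left distrib_left mult.left_commute)
  have "V z $ i * (pd_t \<rho> z + (\<Sum>j\<in>UNIV. V z $ j * pd_x j \<rho> z)
      + \<rho> z * (\<Sum>j\<in>UNIV. pd_x j (\<lambda>y. V y $ j) z)) = 0"
    using mass_equation[OF assms] by simp
  with 3 show ?thesis unfolding 1 4 by (simp add: algebra_simps)
qed

text \<open>
Where \<open>\<rho> z > 0\<close> this is the chain rule. Where \<open>\<rho> z = 0\<close>, the argument of the real power is at the end
of its range; but there the nonnegative function \<open>p\<close> has an interior minimum and all its derivatives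
vanish, as does the right-hand side.
\<close>

lemma dirderiv_pressure:
  assumes "z \<in> interior \<Omega>"
  shows "dirderiv v p z = p z * dirderiv v S z + \<gamma> * exp (S z) * \<rho> z powr (\<gamma> - 1) * dirderiv v \<rho> z"
proof (cases "\<rho> z > 0")
  case True
  note d = differentiable[OF assms]
  have 1: "dirderiv v p z = dirderiv v (\<lambda>y. exp (S y) * \<rho> y powr \<gamma>) z"
    by (rule dirderiv_cong_open[of "interior \<Omega>"]) (use assms p_eq interior_subset in auto)
  have h: "((\<lambda>y. exp (S y) * \<rho> y powr \<gamma>) has_derivative
      (\<lambda>h. exp (S z) * (\<gamma> * \<rho> z powr (\<gamma> - 1) * dirderiv h \<rho> z) + (exp (S z) * dirderiv h S z) * \<rho> z powr \<gamma>)) (at z)"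
  proof (rule has_derivative_mult)
    show "((\<lambda>y. exp (S y)) has_derivative (\<lambda>h. exp (S z) * dirderiv h S z)) (at z)"
      using dirderiv_works[OF d(3)] by (auto intro!: derivative_eq_intros)
    have "((\<lambda>s. s powr \<gamma>) has_derivative (*) (\<gamma> * \<rho> z powr (\<gamma> - 1))) (at (\<rho> z))"
      using has_real_derivative_powr[OF True, of \<gamma>] by (simp add: has_field_derivative_def)
    from has_derivative_compose[OF dirderiv_works[OF d(1)] this]
    show "((\<lambda>y. \<rho> y powr \<gamma>) has_derivative (\<lambda>h. \<gamma> * \<rho> z powr (\<gamma> - 1) * dirderiv h \<rho> z)) (at z)" .
  qed
  have "p z = exp (S z) * \<rho> z powr \<gamma>" using p_eq assms interior_subset by blast
  then show ?thesis unfolding 1 dirderivI[OF h] by (simp add: algebra_simps)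
next
  case False
  have sub: "\<And>y. y \<in> interior \<Omega> \<Longrightarrow> y \<in> \<Omega>" using interior_subset by blast
  have r0: "\<rho> z = 0" using False rho_nonneg[OF sub[OF assms]] by simp
  have p0: "p z = 0" using p_eq[OF sub[OF assms]] r0 by simp
  have "(\<lambda>v. dirderiv v p z) = (\<lambda>v. 0)"
    by (rule differential_zero_maxmin[OF assms open_interior dirderiv_works[OF differentiable(2)[OF assms]]])
      (use p0 p_nonneg sub in auto)
  then have "dirderiv v p z = 0" by metis
  then show ?thesis using p0 r0 by simp
qed

text \<open>
By the equation of state the transport of entropy and the mass equation combine to an equation for
the pressure in which the entropy no longer appears, and which persists in vacuum.
\<close>

lemma pressure_equation:
  assumes "z \<in> interior \<Omega>"
  shows "pd_t p z + (\<Sum>j\<in>UNIV. V z $ j * pd_x j p z) + \<gamma> * p z * (\<Sum>j\<in>UNIV. pd_x j (\<lambda>y. V y $ j) z) = 0"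
proof -
  define K where "K = \<gamma> * exp (S z) * \<rho> z powr (\<gamma> - 1)"
  have K: "K * \<rho> z = \<gamma> * p z"
  proof -
    have "z \<in> \<Omega>" using assms interior_subset by blast
    then have "\<rho> z powr (\<gamma> - 1) * \<rho> z = \<rho> z powr \<gamma>"
      using rho_nonneg[of z] powr_add[of "\<rho> z" "\<gamma> - 1" 1] by (cases "\<rho> z = 0") auto
    then show ?thesis using p_eq[OF \<open>z \<in> \<Omega>\<close>] by (simp add: K_def mult.assoc)
  qed
  have t: "pd_t p z = p z * pd_t S z + K * pd_t \<rho> z"
    and x: "pd_x j p z = p z * pd_x j S z + K * pd_x j \<rho> z" for j
    unfolding pd_t_eq_dirderiv pd_x_eq_dirderiv K_def by (rule dirderiv_pressure[OF assms])+
  have S: "pd_t S z + (\<Sum>j\<in>UNIV. V z $ j * pd_x j S z) = 0"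
    using solution assms by (auto simp: euler_solution_def)
  have "(\<Sum>j\<in>UNIV. V z $ j * pd_x j p z) =
      p z * (\<Sum>j\<in>UNIV. V z $ j * pd_x j S z) + K * (\<Sum>j\<in>UNIV. V z $ j * pd_x j \<rho> z)"
    unfolding x by (simp add: distrib_left sum.distrib sum_distrib_left mult.left_commute)
  then have "pd_t p z + (\<Sum>j\<in>UNIV. V z $ j * pd_x j p z) + K * \<rho> z * (\<Sum>j\<in>UNIV. pd_x j (\<lambda>y. V y $ j) z) =
     p z * (pd_t S z + (\<Sum>j\<in>UNIV. V z $ j * pd_x j S z)) +
     K * (pd_t \<rho> z + (\<Sum>j\<in>UNIV. V z $ j * pd_x j \<rho> z) + \<rho> z * (\<Sum>j\<in>UNIV. pd_x j (\<lambda>y. V y $ j) z))"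
    unfolding t by (simp add: algebra_simps)
  then show ?thesis unfolding S mass_equation[OF assms] K by simp
qed

end

section \<open>Finite speed of propagation\<close>

text \<open>
The function \<open>\<lambda>t. exp (- C * t) * y t\<close> does not increase.
\<close>

lemma gronwall_zero:
  fixes y :: "real \<Rightarrow> real"
  assumes cont: "continuous_on {a..b} y" and "a \<le> b"
    and deriv: "\<And>t. a < t \<Longrightarrow> t < b \<Longrightarrow> \<exists>y'. (y has_real_derivative y') (at t) \<and> y' \<le> C * y t"
    and "y a = 0" "0 \<le> y b"
  shows "y b = 0"
proof (cases "a < b")
  case True
  have "exp (- C * b) * y b \<le> exp (- C * a) * y a"
  proof (rule DERIV_nonpos_imp_decreasing_open[OF less_imp_le[OF True]])
    fix t assume t: "a < t" "t < b"
    from deriv[OF t] obtain y' where y': "(y has_real_derivative y') (at t)" "y' \<le> C * y t" by blast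
    have "((\<lambda>t. exp (- C * t) * y t) has_real_derivative exp (- C * t) * (y' - C * y t)) (at t)"
      using y'(1) by (auto intro!: derivative_eq_intros simp: algebra_simps)
    moreover have "exp (- C * t) * (y' - C * y t) \<le> 0"
      using y'(2) by (simp add: mult_le_0_iff)
    ultimately show "\<exists>d. ((\<lambda>t. exp (- C * t) * y t) has_real_derivative d) (at t) \<and> d \<le> 0" by blast
  qed (intro continuous_intros cont)
  then show ?thesis using assms by (simp add: mult_le_0_iff)
qed (use assms in auto)

text \<open>
The square of the positive part serves as a profile that vanishes on a half line and is still
continuously differentiable.
\<close>

lemma has_real_derivative_max_0_square:
  "((\<lambda>s. (max 0 s)\<^sup>2) has_real_derivative 2 * max 0 s) (at s)" for s :: real
proof -
  consider "s < 0" | "s = 0" | "s > 0" by linarith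
  then show ?thesis
  proof cases
    case 1
    have "((\<lambda>s. (max 0 s)\<^sup>2) has_real_derivative 0) (at s)"
      by (rule has_field_derivative_transform_within_open[OF DERIV_const[of 0] open_lessThan[of 0]])
        (use 1 in auto)
    then show ?thesis using 1 by simp
  next
    case 2
    have "((\<lambda>h. max 0 h) \<longlongrightarrow> max 0 0) (at (0::real))"
      by (intro tendsto_intros)
    moreover have "\<forall>\<^sub>F h in at (0::real). max 0 h = ((max 0 (0 + h))\<^sup>2 - (max 0 0)\<^sup>2) / h"
      by (auto simp: eventually_at_filter power2_eq_square max_def)
    ultimately show ?thesis
      using 2 by (auto simp: DERIV_def intro: Lim_transform_eventually)
  next
    case 3
    have "((\<lambda>s. s\<^sup>2) has_real_derivative 2 * s) (at s)"
      by (auto intro!: derivative_eq_intros)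
    then have "((\<lambda>s. (max 0 s)\<^sup>2) has_real_derivative 2 * s) (at s)"
      by (rule has_field_derivative_transform_within_open[OF _ open_greaterThan[of 0]])
        (use 3 in auto)
    then show ?thesis using 3 by simp
  qed
qed

text \<open>
Integrating against the weight \<open>\<eta>\<close> replaces the integration over a ball that shrinks with speed \<open>\<sigma>\<close>
from the radius \<open>m\<close> at time \<open>t0\<close>: the decay in time, \<open>\<sigma> * \<psi>\<close>, is \<open>\<sigma>\<close> times a bound for the gradient,
which plays the part of the boundary term. The norm of \<open>x - c\<close> is regularised to \<open>sqrt (e\<^sup>2 + (norm (x - c))\<^sup>2)\<close>,
which is smooth at the centre, exceeds the norm, and has a gradient of length at most one; the price
is that the weight is positive at the centre only until \<open>m - \<sigma> * (t - t0)\<close> has dropped to \<open>e\<close>.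
\<close>

lemma cone_weight:
  fixes c :: "real^'n" and \<sigma> m t0 e :: real
  assumes "e > 0"
  obtains \<eta> \<psi> :: "(real^'n) \<times> real \<Rightarrow> real" and w :: "(real^'n) \<times> real \<Rightarrow> real^'n" where
    "C1_open UNIV \<eta>" "\<And>z. \<eta> z \<ge> 0" "\<And>z. \<psi> z \<ge> 0" "\<And>z. norm (w z) \<le> 1"
    "\<And>z. pd_t \<eta> z = - (\<sigma> * \<psi> z)" "\<And>z j. pd_x j \<eta> z = - (\<psi> z * w z $ j)"
    "\<And>x t. m - \<sigma> * (t - t0) \<le> dist c x \<Longrightarrow> \<eta> (x, t) = 0"
    "\<And>t. e < m - \<sigma> * (t - t0) \<Longrightarrow> \<eta> (c, t) > 0"
proof -
  define Q where "Q = (\<lambda>z::(real^'n) \<times> real. e * e + (\<Sum>i\<in>UNIV. (fst z $ i - c $ i) * (fst z $ i - c $ i)))"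
  define A where "A = (\<lambda>z. m - \<sigma> * (snd z - t0) - sqrt (Q z))"
  have QC: "C1_open UNIV Q"
    unfolding Q_def by (intro C1_open_intros C1_open_fst)
  have Q_norm: "Q z = e\<^sup>2 + (norm (fst z - c))\<^sup>2" for z
    by (simp add: Q_def power2_eq_square norm_vec_def L2_set_def sum_nonneg)
  have Qpos: "Q z > 0" for z using assms by (simp add: Q_norm add_pos_nonneg)
  have norm_le: "norm (fst z - c) < sqrt (Q z)" for z
    using assms by (intro real_less_rsqrt) (simp add: Q_norm)
  have diff_fst: "(\<lambda>z. fst z $ i) differentiable (at z)" for z :: "(real^'n) \<times> real" and i
    using C1_open_differentiable[OF C1_open_fst[of UNIV]] by simp
  have Qt: "pd_t Q z = 0" for z
    unfolding Q_def using diff_fst by (simp add: pd_t_rules pd_t_fst)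
  have Qx: "pd_x j Q z = 2 * (fst z $ j - c $ j)" for j z
  proof -
    have "pd_x j (\<lambda>z. (fst z $ i - c $ i) * (fst z $ i - c $ i)) z =
        (if i = j then 2 * (fst z $ j - c $ j) else 0)" for i
      using diff_fst by (auto simp: pd_x_rules pd_x_fst)
    then show ?thesis
      unfolding Q_def using diff_fst by (simp add: pd_x_rules)
  qed
  have dsqrt: "(sqrt has_real_derivative inverse (sqrt s) / 2) (at s)" if "s > 0" for s
    using that by (rule DERIV_real_sqrt)
  have sQC: "C1_open UNIV (\<lambda>z. sqrt (Q z))"
    by (rule C1_open_compose[OF QC, of "{0<..}" sqrt "\<lambda>s. inverse (sqrt s) / 2"])
      (use Qpos dsqrt in \<open>auto intro!: continuous_intros\<close>)
  have bls: "bounded_linear (snd :: (real^'n) \<times> real \<Rightarrow> real)" by (rule bounded_linear_snd)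
  have AC: "C1_open UNIV A"
    unfolding A_def by (intro C1_open_intros sQC C1_open_linear bls)
  have At: "pd_t A z = - \<sigma>" for z
  proof -
    have "pd_t (\<lambda>z. sqrt (Q z)) z = 0"
      using dirderiv_compose[OF C1_open_differentiable[OF QC] dsqrt[OF Qpos], of z "(0, 1)"] Qt[of z]
      by (simp add: pd_t_eq_dirderiv)
    moreover have "pd_t snd z = 1"
      unfolding pd_t_eq_dirderiv by (simp add: dirderiv_linear[OF bls])
    ultimately show ?thesis
      using C1_open_differentiable[OF sQC] bounded_linear_imp_differentiable[OF bls]
      unfolding A_def by (simp add: pd_t_rules)
  qed
  have Ax: "pd_x j A z = - ((fst z - c) $ j / sqrt (Q z))" for j z
  proof -
    have "pd_x j (\<lambda>z. sqrt (Q z)) z = (fst z - c) $ j / sqrt (Q z)"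
    proof -
      have 1: "inverse s / 2 * (2 * x) = x / s" for s x :: real
        by (cases "s = 0") (auto simp: field_simps)
      show ?thesis
        using dirderiv_compose[OF C1_open_differentiable[OF QC] dsqrt[OF Qpos], of z "(axis j 1, 0)"]
        unfolding pd_x_eq_dirderiv[symmetric] Qx 1 by simp
    qed
    moreover have "pd_x j snd z = 0"
      unfolding pd_x_eq_dirderiv by (simp add: dirderiv_linear[OF bls])
    ultimately show ?thesis
      using C1_open_differentiable[OF sQC] bounded_linear_imp_differentiable[OF bls]
      unfolding A_def by (simp add: pd_x_rules)
  qed
  define \<eta> where "\<eta> = (\<lambda>z. (max 0 (A z))\<^sup>2)"
  have \<eta>d: "dirderiv v \<eta> z = 2 * max 0 (A z) * dirderiv v A z" for v z
    unfolding \<eta>_def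
    by (rule dirderiv_compose[OF C1_open_differentiable[OF AC] has_real_derivative_max_0_square]) simp
  have \<eta>C: "C1_open UNIV \<eta>"
    unfolding \<eta>_def
    by (rule C1_open_compose[OF AC, of UNIV "\<lambda>s. (max 0 s)\<^sup>2" "\<lambda>s. 2 * max 0 s"])
      (auto intro!: continuous_intros has_real_derivative_max_0_square)
  show thesis
  proof (rule that[of \<eta> "\<lambda>z. 2 * max 0 (A z)" "\<lambda>z. (fst z - c) /\<^sub>R sqrt (Q z)"])
    show "norm ((fst z - c) /\<^sub>R sqrt (Q z)) \<le> 1" for z
      using norm_le[of z] Qpos[of z] by (simp add: divide_simps)
    show "pd_t \<eta> z = - (\<sigma> * (2 * max 0 (A z)))" for z
      using At[of z] by (simp add: \<eta>d pd_t_eq_dirderiv)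
    show "pd_x j \<eta> z = - (2 * max 0 (A z) * ((fst z - c) /\<^sub>R sqrt (Q z)) $ j)" for z j
      using Ax[of j z] by (simp add: \<eta>d pd_x_eq_dirderiv divide_inverse mult.commute)
    show "\<eta> (x, t) = 0" if "m - \<sigma> * (t - t0) \<le> dist c x" for x t
      using that norm_le[of "(x, t)"] by (simp add: \<eta>_def A_def dist_norm norm_minus_commute)
    show "\<eta> (c, t) > 0" if "e < m - \<sigma> * (t - t0)" for t
      using that assms by (simp add: \<eta>_def A_def Q_norm)
  qed (use \<eta>C in \<open>simp_all add: \<eta>_def\<close>)
qed

text \<open>
The energy flux \<open>P * v\<close> of the acoustic equations is at most \<open>\<sigma>\<close> times the energy density, by the
inequality of arithmetic and geometric means. This is where the value of the sound speed enters:
\<open>\<sigma> = sqrt (a / r)\<close> makes the bound an equality for a suitable ratio of \<open>P\<close> and \<open>norm v\<close>.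
\<close>

lemma acoustic_flux_bound:
  fixes v w :: "real^'n"
  assumes "r > 0" "a > 0" and \<sigma>: "\<sigma> = sqrt (a / r)" and w: "norm w \<le> 1"
  shows "\<bar>P * (v \<bullet> w)\<bar> \<le> \<sigma> * ((r * (v \<bullet> v) + P * P / a) / 2)"
proof -
  have s: "\<sigma> > 0" "\<sigma> * \<sigma> = a / r" using assms by (auto simp: real_sqrt_mult_self)
  have "\<bar>v \<bullet> w\<bar> \<le> norm v * norm w" by (rule Cauchy_Schwarz_ineq2)
  also have "\<dots> \<le> norm v" using w by (simp add: mult_left_le)
  finally have "\<bar>P * (v \<bullet> w)\<bar> \<le> \<bar>P\<bar> * norm v"
    by (simp add: abs_mult mult_left_mono)
  also have "\<dots> \<le> \<sigma> * ((r * (v \<bullet> v) + P * P / a) / 2)"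
  proof -
    have "0 \<le> (\<sigma> * r * norm v - \<bar>P\<bar>)\<^sup>2" by simp
    also have "\<dots> = (\<sigma> * \<sigma>) * r * r * (norm v)\<^sup>2 - 2 * \<sigma> * r * (\<bar>P\<bar> * norm v) + P * P"
      by (simp add: power2_eq_square algebra_simps)
    also have "\<dots> = a * r * (v \<bullet> v) - 2 * \<sigma> * r * (\<bar>P\<bar> * norm v) + P * P"
      using assms(1) unfolding s(2) by (simp add: power2_norm_eq_inner)
    finally have "\<sigma> * r * (2 * (\<bar>P\<bar> * norm v)) \<le> a * (r * (v \<bullet> v) + P * P / a)"
      using assms(2) by (simp add: algebra_simps)
    also have "a = \<sigma> * \<sigma> * r" using s assms by simp
    finally have "(\<sigma> * r) * (2 * (\<bar>P\<bar> * norm v)) \<le> (\<sigma> * r) * (\<sigma> * (r * (v \<bullet> v) + P * P / (\<sigma> * \<sigma> * r)))"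
      by (simp add: mult_ac)
    then have "2 * (\<bar>P\<bar> * norm v) \<le> \<sigma> * (r * (v \<bullet> v) + P * P / (\<sigma> * \<sigma> * r))"
      using s assms(1) by (subst (asm) mult_le_cancel_left_pos) auto
    then show ?thesis using s assms by simp
  qed
  finally show ?thesis .
qed

lemma abs_sum_mult_le:
  fixes v d :: "'n::finite \<Rightarrow> real"
  assumes "\<And>j. \<bar>d j\<bar> \<le> M"
  shows "\<bar>\<Sum>j\<in>UNIV. v j * d j\<bar> \<le> M * (\<Sum>j\<in>UNIV. \<bar>v j\<bar>)"
proof -
  have "\<bar>\<Sum>j\<in>UNIV. v j * d j\<bar> \<le> (\<Sum>j\<in>UNIV. \<bar>v j * d j\<bar>)" by (rule sum_abs)
  also have "\<dots> \<le> (\<Sum>j\<in>UNIV. M * \<bar>v j\<bar>)"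
    using assms by (intro sum_mono) (simp add: abs_mult mult.commute mult_right_mono)
  finally show ?thesis by (simp add: sum_distrib_left)
qed

text \<open>
The energy method for the difference to the background, at a single point: \<open>v\<close>, \<open>r\<close> and \<open>pr\<close> are the
values of velocity, density and pressure, and \<open>vt\<close>, \<open>dv\<close>, \<open>dp\<close>, \<open>dr\<close>, \<open>rt\<close>, \<open>pt\<close> those of their
derivatives. The unknowns are \<open>v\<close>, \<open>P\<close> and \<open>q\<close>. The variable \<open>q\<close> replaces the density perturbation
because it decouples: in the linearised equations \<open>(v, P)\<close> satisfies the acoustic system and \<open>q\<close> is
constant in time. The left-hand side collects the three residuals, each multiplied by its unknown;
each residual is linear in \<open>(v, P, q)\<close> with coefficients bounded in terms of \<open>M\<close>, so the sum is
quadratic in the unknowns and bounded by a multiple of the energy.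
\<close>

lemma perturbation_energy_rate:
  fixes \<gamma> rb pb s2 a M :: real
  assumes pos: "\<gamma> > 1" "rb > 0" "s2 > 0" "M \<ge> 0" and a: "a = \<gamma> * pb" "a > 0" "s2 * rb = a"
  shows "\<exists>C\<ge>0. \<forall>(v::'n::finite \<Rightarrow> real) vt dv dp dr r rt pr pt P q.
     (\<forall>i. r * vt i + r * (\<Sum>j\<in>UNIV. v j * dv j i) + dp i = 0) \<longrightarrow>
     pt + (\<Sum>j\<in>UNIV. v j * dp j) + \<gamma> * pr * (\<Sum>j\<in>UNIV. dv j j) = 0 \<longrightarrow>
     rt + (\<Sum>j\<in>UNIV. v j * dr j) + r * (\<Sum>j\<in>UNIV. dv j j) = 0 \<longrightarrow>
     \<bar>r\<bar> \<le> M \<longrightarrow> (\<forall>i. \<bar>vt i\<bar> \<le> M) \<longrightarrow> (\<forall>j i. \<bar>dv j i\<bar> \<le> M) \<longrightarrow> (\<forall>j. \<bar>dp j\<bar> \<le> M) \<longrightarrow> (\<forall>j. \<bar>dr j\<bar> \<le> M) \<longrightarrow>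
     P = pr - pb \<longrightarrow> q = P - s2 * (r - rb) \<longrightarrow>
     (\<Sum>i\<in>UNIV. v i * (rb * vt i + dp i)) + P / a * (pt + a * (\<Sum>j\<in>UNIV. dv j j)) + q * (pt - s2 * rt)
       \<le> C * ((rb * (\<Sum>i\<in>UNIV. v i * v i) + P * P / a + q * q) / 2)"
proof -
  define n where "n = real CARD('n)"
  have n0: "n \<ge> 0" by (simp add: n_def)
  \<comment> \<open>\<open>K\<close> dominates the coefficients of all three residuals; \<open>C\<close> then arises from \<open>L\<^sup>2\<close>, where \<open>L\<close> is the
    sum of the absolute values of the unknowns, by comparing it with the energy.\<close>
  define K where "K = (M / s2 + M * M) + (M + \<gamma> * n * M) + (s2 * M + n * M)"
  have K0: "K \<ge> 0" using pos n0 by (simp add: K_def)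
  define C where "C = K * (2 + 1 / a) * (3 * (2 * a + 2 + n * (2 / rb)))"
  have C0: "C \<ge> 0" using K0 pos a n0 by (simp add: C_def)
  show ?thesis
  proof (intro exI[of _ C] conjI C0 allI impI)
    fix v vt :: "'n \<Rightarrow> real" and dv dp dr r rt pr pt P q
    assume mom: "\<forall>i. r * vt i + r * (\<Sum>j\<in>UNIV. v j * dv j i) + dp i = 0"
      and prs: "pt + (\<Sum>j\<in>UNIV. v j * dp j) + \<gamma> * pr * (\<Sum>j\<in>UNIV. dv j j) = 0"
      and mass: "rt + (\<Sum>j\<in>UNIV. v j * dr j) + r * (\<Sum>j\<in>UNIV. dv j j) = 0"
      and M: "\<bar>r\<bar> \<le> M" "\<forall>i. \<bar>vt i\<bar> \<le> M" "\<forall>j i. \<bar>dv j i\<bar> \<le> M" "\<forall>j. \<bar>dp j\<bar> \<le> M" "\<forall>j. \<bar>dr j\<bar> \<le> M"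
      and P: "P = pr - pb" and q: "q = P - s2 * (r - rb)"
    define v1 where "v1 = (\<Sum>j\<in>UNIV. \<bar>v j\<bar>)"
    define L where "L = \<bar>P\<bar> + \<bar>q\<bar> + v1"
    define dvg where "dvg = (\<Sum>j\<in>UNIV. dv j j)"
    define E where "E = (rb * (\<Sum>i\<in>UNIV. v i * v i) + P * P / a + q * q) / 2"
    have v10: "v1 \<ge> 0" by (simp add: v1_def sum_nonneg)
    have L: "\<bar>P\<bar> \<le> L" "\<bar>q\<bar> \<le> L" "v1 \<le> L" "\<bar>P - q\<bar> \<le> L" "0 \<le> L"
      using v10 by (auto simp: L_def)
    have dvg: "\<bar>dvg\<bar> \<le> n * M"
      using order_trans[OF sum_abs[of "\<lambda>j. dv j j" UNIV] sum_bounded_above[of UNIV "\<lambda>j. \<bar>dv j j\<bar>" M]] M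
      by (simp add: dvg_def n_def)
    have s: "\<bar>\<Sum>j\<in>UNIV. v j * d j\<bar> \<le> M * L" if "\<forall>j. \<bar>d j\<bar> \<le> M" for d
      using abs_sum_mult_le[of d M v] that mult_left_mono[OF L(3) pos(4)]
      unfolding v1_def[symmetric] by fastforce
    have sdp: "\<bar>\<Sum>j\<in>UNIV. v j * dp j\<bar> \<le> M * L" by (rule s[OF M(4)])
    have sdr: "\<bar>\<Sum>j\<in>UNIV. v j * dr j\<bar> \<le> M * L" by (rule s[OF M(5)])
    have sdv: "\<bar>\<Sum>j\<in>UNIV. v j * dv j i\<bar> \<le> M * L" for i by (rule s) (use M(3) in blast)
    have Pd: "\<bar>\<gamma> * P * dvg\<bar> \<le> \<gamma> * n * M * L"
    proof -
      have "\<bar>P\<bar> * \<bar>dvg\<bar> \<le> L * (n * M)" using L dvg by (intro mult_mono) auto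
      then have "\<gamma> * (\<bar>P\<bar> * \<bar>dvg\<bar>) \<le> \<gamma> * (L * (n * M))" using pos by (intro mult_left_mono) auto
      then show ?thesis using pos by (simp add: abs_mult mult_ac)
    qed
    have rD: "r - rb = (P - q) / s2" using q pos by simp
    have e1: "\<bar>rb * vt i + dp i\<bar> \<le> K * L" for i
    proof -
      have "rb * vt i + dp i = - (r - rb) * vt i - r * (\<Sum>j\<in>UNIV. v j * dv j i)"
        using spec[OF mom, of i] by (simp add: algebra_simps)
      then have "\<bar>rb * vt i + dp i\<bar> \<le> \<bar>r - rb\<bar> * \<bar>vt i\<bar> + \<bar>r\<bar> * \<bar>\<Sum>j\<in>UNIV. v j * dv j i\<bar>"
        using abs_triangle_ineq4[of "- (r - rb) * vt i" "r * (\<Sum>j\<in>UNIV. v j * dv j i)"]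
        by (simp only: abs_mult abs_minus_cancel)
      also have "\<dots> \<le> (L / s2) * M + M * (M * L)"
      proof (intro add_mono mult_mono)
        show "\<bar>r - rb\<bar> \<le> L / s2" using L pos by (simp add: rD divide_right_mono)
      qed (use L(5) M(1,2) pos sdv[of i] in \<open>simp_all add: divide_nonneg_pos\<close>)
      also have "\<dots> = (M / s2 + M * M) * L" by (simp add: algebra_simps)
      also have "\<dots> \<le> K * L"
        using L pos n0 by (intro mult_right_mono) (auto simp: K_def)
      finally show ?thesis .
    qed
    have e2: "\<bar>pt + a * dvg\<bar> \<le> K * L"
    proof -
      have "pt + a * dvg = - (\<Sum>j\<in>UNIV. v j * dp j) - \<gamma> * P * dvg"
        using prs by (simp add: a P dvg_def algebra_simps)
      then have "\<bar>pt + a * dvg\<bar> \<le> M * L + \<gamma> * n * M * L" using sdp Pd by linarith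
      also have "\<dots> = (M + \<gamma> * n * M) * L" by (simp add: algebra_simps)
      also have "\<dots> \<le> K * L"
        using L pos n0 by (intro mult_right_mono) (auto simp: K_def)
      finally show ?thesis .
    qed
    have e3: "\<bar>pt - s2 * rt\<bar> \<le> K * L"
    proof -
      have "s2 * r = a + (P - q)" using q a(3) by (simp add: algebra_simps)
      then have 1: "(s2 * r) * dvg = a * dvg + (P - q) * dvg" by (metis distrib_right)
      have 2: "\<gamma> * pr * dvg = a * dvg + \<gamma> * P * dvg" unfolding a(1) P by (simp add: algebra_simps)
      have "s2 * (rt + (\<Sum>j\<in>UNIV. v j * dr j) + r * dvg) = 0" using mass by (simp add: dvg_def)
      then have "s2 * rt + s2 * (\<Sum>j\<in>UNIV. v j * dr j) + (s2 * r) * dvg = 0" by (simp add: algebra_simps)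
      then have "pt - s2 * rt = - (\<Sum>j\<in>UNIV. v j * dp j) - \<gamma> * P * dvg
          + s2 * (\<Sum>j\<in>UNIV. v j * dr j) + (P - q) * dvg"
        using prs[folded dvg_def] 1 2 by linarith
      moreover have "\<bar>s2 * (\<Sum>j\<in>UNIV. v j * dr j)\<bar> \<le> s2 * (M * L)"
        using sdr pos by (simp add: abs_mult)
      moreover have "\<bar>(P - q) * dvg\<bar> \<le> L * (n * M)"
        unfolding abs_mult using L dvg by (intro mult_mono) auto
      ultimately have "\<bar>pt - s2 * rt\<bar> \<le> M * L + \<gamma> * n * M * L + s2 * (M * L) + L * (n * M)"
        using sdp Pd by linarith
      also have "\<dots> = ((M + \<gamma> * n * M) + (s2 * M + n * M)) * L" by (simp add: algebra_simps)
      also have "\<dots> \<le> K * L"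
        using L pos n0 by (intro mult_right_mono) (auto simp: K_def)
      finally show ?thesis .
    qed
    have "(\<Sum>i\<in>UNIV. v i * (rb * vt i + dp i)) \<le> K * L * v1"
      using abs_sum_mult_le[of "\<lambda>i. rb * vt i + dp i" "K * L" v] e1 by (simp add: v1_def)
    also have "\<dots> \<le> K * L * L" using L K0 by (intro mult_left_mono) auto
    finally have b1: "(\<Sum>i\<in>UNIV. v i * (rb * vt i + dp i)) \<le> K * L * L" .
    have "P / a * (pt + a * dvg) \<le> \<bar>P / a\<bar> * \<bar>pt + a * dvg\<bar>"
      using abs_ge_self[of "P / a * (pt + a * dvg)"] by (simp only: abs_mult)
    also have "\<dots> \<le> (L / a) * (K * L)"
      using L a e2 by (intro mult_mono) (auto simp: abs_divide divide_right_mono)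
    finally have b2: "P / a * (pt + a * dvg) \<le> (L / a) * (K * L)" .
    have "q * (pt - s2 * rt) \<le> \<bar>q\<bar> * \<bar>pt - s2 * rt\<bar>"
      using abs_ge_self[of "q * (pt - s2 * rt)"] by (simp only: abs_mult)
    also have "\<dots> \<le> L * (K * L)"
      using L e3 by (intro mult_mono) auto
    finally have b3: "q * (pt - s2 * rt) \<le> L * (K * L)" .
    have "v1\<^sup>2 \<le> n * (\<Sum>i\<in>UNIV. v i * v i)"
      using sum_squared_le_sum_of_squares[of "\<lambda>i. \<bar>v i\<bar>" "UNIV :: 'n set"]
      by (simp add: v1_def n_def power2_eq_square mult.commute)
    moreover have "(\<Sum>i\<in>UNIV. v i * v i) \<le> (2 / rb) * E" and PE: "P * P \<le> 2 * a * E" and qE: "q * q \<le> 2 * E"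
    proof -
      have "0 \<le> (\<Sum>i\<in>UNIV. v i * v i)" by (rule sum_nonneg) simp
      then have nn: "0 \<le> (\<Sum>i\<in>UNIV. v i * v i)" "0 \<le> P * P / a" "0 \<le> q * q" "0 \<le> rb * (\<Sum>i\<in>UNIV. v i * v i)"
        using a(2) pos(2) by simp_all
      have E2: "2 * E = rb * (\<Sum>i\<in>UNIV. v i * v i) + P * P / a + q * q" by (simp add: E_def)
      show "q * q \<le> 2 * E" using nn E2 by linarith
      have "P * P / a \<le> 2 * E" using nn E2 by linarith
      then show "P * P \<le> 2 * a * E" using a by (simp add: field_simps)
      have "rb * (\<Sum>i\<in>UNIV. v i * v i) \<le> 2 * E" using nn E2 by linarith
      then show "(\<Sum>i\<in>UNIV. v i * v i) \<le> (2 / rb) * E" using pos by (simp add: field_simps)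
    qed
    ultimately have vE: "v1\<^sup>2 \<le> n * ((2 / rb) * E)"
      using mult_left_mono[OF _ n0] by (meson order_trans)
    have "L * L \<le> 3 * (P * P + q * q + v1\<^sup>2)"
    proof -
      have "0 \<le> (\<bar>P\<bar> - \<bar>q\<bar>)\<^sup>2 + (\<bar>P\<bar> - v1)\<^sup>2 + (\<bar>q\<bar> - v1)\<^sup>2" by simp
      then show ?thesis by (simp add: L_def power2_eq_square algebra_simps)
    qed
    also have "\<dots> \<le> 3 * (2 * a * E + 2 * E + n * ((2 / rb) * E))"
      using vE PE qE by simp
    also have "\<dots> = 3 * (2 * a + 2 + n * (2 / rb)) * E" by (simp add: algebra_simps)
    finally have LE: "L * L \<le> 3 * (2 * a + 2 + n * (2 / rb)) * E" .
    have "(\<Sum>i\<in>UNIV. v i * (rb * vt i + dp i)) + P / a * (pt + a * dvg) + q * (pt - s2 * rt)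
        \<le> K * L * L + (L / a) * (K * L) + L * (K * L)" using b1 b2 b3 by linarith
    also have "\<dots> = K * (2 + 1 / a) * (L * L)" by (simp add: algebra_simps)
    also have "\<dots> \<le> K * (2 + 1 / a) * (3 * (2 * a + 2 + n * (2 / rb)) * E)"
      using LE K0 a by (intro mult_left_mono) auto
    finally show "(\<Sum>i\<in>UNIV. v i * (rb * vt i + dp i)) + P / a * (pt + a * (\<Sum>j\<in>UNIV. dv j j)) + q * (pt - s2 * rt)
       \<le> C * ((rb * (\<Sum>i\<in>UNIV. v i * v i) + P * P / a + q * q) / 2)"
      unfolding C_def E_def[symmetric] dvg_def[symmetric] by (simp add: mult.assoc)
  qed
qed

context euler_flow
begin

text \<open>
The energy \<open>E\<close> of the difference to the background is multiplied by the cone weight and integrated.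
In the time derivative the terms with derivatives of the weight have a sign, because the flux is at
most \<open>\<sigma> * E\<close>, and the remaining terms are bounded by a multiple of the energy. Gronwall's inequality
shows that the weighted energy stays zero, and at the apex the weight is positive.

The set \<open>X\<close> is the whole space for a solution before its breakdown, and a ball for a solution that is
only known inside this ball.
\<close>

lemma domain_of_dependence:
  fixes \<sigma> rb pb t0 t1 m :: real and c :: "real^'n"
  assumes bg: "rb > 0" "pb > 0" and \<sigma>: "\<sigma> = sqrt (\<gamma> * pb / rb)"
    and X: "open X" "cball c m \<subseteq> X" "X \<times> {t0..t1} \<subseteq> \<Omega>" and t: "t0 \<le> t1" "\<sigma> * (t1 - t0) < m"
    and init: "\<And>x. x \<in> ball c m \<Longrightarrow> V (x, t0) = 0 \<and> \<rho> (x, t0) = rb \<and> p (x, t0) = pb"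
  shows "V (c, t1) = 0 \<and> \<rho> (c, t1) = rb \<and> p (c, t1) = pb"
proof -
  define a where "a = \<gamma> * pb"
  define s2 where "s2 = a / rb"
  have a: "a > 0" and s2: "s2 > 0" "s2 * rb = a" using bg gamma by (auto simp: a_def s2_def)
  have \<sigma>0: "\<sigma> > 0" using bg gamma by (simp add: \<sigma>)
  define P where "P = (\<lambda>z. p z - pb)"
  define q where "q = (\<lambda>z. P z - s2 * (\<rho> z - rb))"
  \<comment> \<open>As named constants the factors stay products under simplification, to which the product rule
    applies.\<close>
  define hf ia :: real where "hf = 1 / 2" and "ia = 1 / a"
  define E where "E = (\<lambda>z. hf * (rb * (\<Sum>i\<in>UNIV. V z $ i * V z $ i) + ia * (P z * P z) + q z * q z))"
  define I where "I = {t0<..<t1}"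
  define W where "W = X \<times> I"
  have oW: "open I" "open W" using X by (auto simp: I_def W_def intro: open_Times)
  have "W \<subseteq> \<Omega>" using X(3) by (auto simp: W_def I_def)
  then have Wi: "W \<subseteq> interior \<Omega>" using oW by (simp add: interior_maximal)
  \<comment> \<open>The regularisation must be fine enough for the weight to be positive at the apex.\<close>
  define e where "e = (m - \<sigma> * (t1 - t0)) / 2"
  have e: "e > 0" "e < m - \<sigma> * (t1 - t0)" using t by (auto simp: e_def)
  obtain \<eta> \<psi> :: "(real^'n) \<times> real \<Rightarrow> real" and w :: "(real^'n) \<times> real \<Rightarrow> real^'n" where
    \<eta>: "C1_open UNIV \<eta>" "\<And>z. \<eta> z \<ge> 0" "\<And>z. \<psi> z \<ge> 0" "\<And>z. norm (w z) \<le> 1"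
    "\<And>z. pd_t \<eta> z = - (\<sigma> * \<psi> z)" "\<And>z j. pd_x j \<eta> z = - (\<psi> z * w z $ j)"
    "\<And>x t. m - \<sigma> * (t - t0) \<le> dist c x \<Longrightarrow> \<eta> (x, t) = 0"
    "\<And>t. e < m - \<sigma> * (t - t0) \<Longrightarrow> \<eta> (c, t) > 0"
  proof (rule cone_weight[OF e(1), of \<sigma> m t0 c], goal_cases)
    case (1 \<eta> \<psi> w)
    show ?case by (rule that[of \<eta> \<psi> w]) (fact 1)+
  qed
  define u where "u = (\<lambda>z. E z * \<eta> z)"
  define F where "F = (\<lambda>j z. P z * V z $ j * \<eta> z)"
  define h where "h = (\<lambda>g (z :: (real^'n) \<times> real). if fst z \<in> X then g z else (0::real))"
  have \<eta>0: "\<eta> (x, t) = 0" if "t0 \<le> t" "x \<notin> cball c m" for x t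
  proof -
    have "0 \<le> \<sigma> * (t - t0)" using that \<sigma>0 by simp
    then show ?thesis using that by (intro \<eta>(7)) auto
  qed
  have sumV0: "0 \<le> (\<Sum>i\<in>UNIV. V z $ i * V z $ i)" for z by (rule sum_nonneg) simp
  have E0: "E z \<ge> 0" for z
    using bg a sumV0[of z] by (simp add: E_def hf_def ia_def)
  note C = C1_open[THEN C1_open_subset, OF Wi]
  have \<eta>C: "C1_open W \<eta>" using \<eta>(1) by (rule C1_open_subset) simp
  have PC: "C1_open W P" unfolding P_def by (intro C1_open_intros C)
  have qC: "C1_open W q" unfolding q_def by (intro C1_open_intros C PC)
  have EC: "C1_open W E" unfolding E_def by (intro C1_open_intros C PC qC)
  have uC: "C1_open W u" unfolding u_def by (intro C1_open_intros EC \<eta>C)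
  have FC: "C1_open W (F j)" for j unfolding F_def by (intro C1_open_intros C PC \<eta>C)
  have huC: "C1_open (UNIV \<times> I) (h u)"
    unfolding h_def
    by (rule C1_open_extend_zero[OF uC[unfolded W_def] X(1) oW(1) closed_cball X(2)])
      (simp add: u_def I_def \<eta>0)
  have hFC: "C1_open (UNIV \<times> I) (h (F j))" for j
    unfolding h_def
    by (rule C1_open_extend_zero[OF FC[unfolded W_def] X(1) oW(1) closed_cball X(2)])
      (simp add: F_def I_def \<eta>0)
  have hu_supp: "h u (x, t) = 0" if "t \<in> {t0..t1}" "x \<notin> cball c m" for x t
    using that by (simp add: h_def u_def \<eta>0)
  have hF_supp: "h (F j) (x, t) = 0" if "t \<in> {t0..t1}" "x \<notin> cball c m" for x t j
    using that by (simp add: h_def F_def \<eta>0)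
  have I_sub: "t \<in> {t0..t1}" if "t \<in> I" for t using that by (simp add: I_def)
  have cont: "continuous_on (UNIV \<times> {t0..t1}) (h u)"
  proof -
    note c = C1[THEN C1_on_continuous, THEN continuous_on_subset, OF X(3)]
    have "continuous_on (X \<times> {t0..t1}) \<eta>"
      using C1_open_continuous[OF \<eta>(1)] by (rule continuous_on_subset) simp
    then have "continuous_on (X \<times> {t0..t1}) u"
      unfolding u_def E_def q_def P_def by (intro continuous_intros c)
    then show ?thesis
      unfolding h_def using X by (rule_tac continuous_on_extend_zero[of _ _ _ "cball c m"]) (auto simp: u_def \<eta>0)
  qed
  define K where "K = cball c m \<times> {t0..t1}"
  have K: "compact K" "K \<subseteq> \<Omega>" using X by (auto simp: K_def intro: compact_Times)
  obtain M where M: "M \<ge> 0" "\<And>z. z \<in> K \<Longrightarrow> \<bar>\<rho> z\<bar> \<le> M"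
    "\<And>z v. z \<in> K \<inter> interior \<Omega> \<Longrightarrow> norm v = 1 \<Longrightarrow> \<bar>dirderiv v \<rho> z\<bar> \<le> M \<and> \<bar>dirderiv v p z\<bar> \<le> M \<and>
       (\<forall>i. \<bar>dirderiv v (\<lambda>z. V z $ i) z\<bar> \<le> M)"
  proof -
    have "compact (\<rho> ` K)"
      by (intro compact_continuous_image continuous_on_subset[OF C1_on_continuous[OF C1(1)]] K)
    then obtain M0 where M0: "\<And>z. z \<in> K \<Longrightarrow> \<bar>\<rho> z\<bar> \<le> M0"
      using compact_imp_bounded bounded_iff by (metis imageI real_norm_def)
    obtain M1 where M1: "M1 \<ge> 0" "\<forall>z\<in>K \<inter> interior \<Omega>. \<forall>v. norm v = 1 \<longrightarrow> \<bar>dirderiv v \<rho> z\<bar> \<le> M1"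
      using C1_on_dirderiv_bounded[OF C1(1) K] by blast
    obtain M2 where M2: "M2 \<ge> 0" "\<forall>z\<in>K \<inter> interior \<Omega>. \<forall>v. norm v = 1 \<longrightarrow> \<bar>dirderiv v p z\<bar> \<le> M2"
      using C1_on_dirderiv_bounded[OF C1(2) K] by blast
    obtain M3 where M3: "\<And>i. M3 i \<ge> 0" "\<And>i. \<forall>z\<in>K \<inter> interior \<Omega>. \<forall>v. norm v = 1 \<longrightarrow>
        \<bar>dirderiv v (\<lambda>z. V z $ i) z\<bar> \<le> M3 i"
      using C1_on_dirderiv_bounded[OF C1(4) K] by metis
    have M3_le: "M3 i \<le> (\<Sum>i\<in>UNIV. M3 i)" for i
      using M3(1) by (intro member_le_sum) auto
    have s0: "0 \<le> (\<Sum>i\<in>UNIV. M3 i)" using M3(1) by (intro sum_nonneg)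
    define T where "T = \<bar>M0\<bar> + M1 + M2 + (\<Sum>i\<in>UNIV. M3 i)"
    have T: "\<bar>M0\<bar> \<le> T" "M1 \<le> T" "M2 \<le> T" "M3 i \<le> T" "0 \<le> T" for i
      using M1(1) M2(1) s0 M3_le[of i] by (auto simp: T_def)
    show thesis
    proof (rule that[OF T(5)])
      show "\<bar>\<rho> z\<bar> \<le> T" if "z \<in> K" for z
        using M0[OF that] T(1) by linarith
      fix z v assume zv: "z \<in> K \<inter> interior \<Omega>" "norm (v :: (real^'n) \<times> real) = 1"
      have "\<bar>dirderiv v \<rho> z\<bar> \<le> M1" "\<bar>dirderiv v p z\<bar> \<le> M2"
        "\<And>i. \<bar>dirderiv v (\<lambda>z. V z $ i) z\<bar> \<le> M3 i" using M1(2) M2(2) M3(2) zv by blast+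
      then show "\<bar>dirderiv v \<rho> z\<bar> \<le> T \<and> \<bar>dirderiv v p z\<bar> \<le> T \<and>
          (\<forall>i. \<bar>dirderiv v (\<lambda>z. V z $ i) z\<bar> \<le> T)"
        using T by (meson order_trans)
    qed
  qed
  obtain B where B: "B \<ge> 0" "\<forall>(v::'n \<Rightarrow> real) vt dv dp dr r rt pr pt P q.
     (\<forall>i. r * vt i + r * (\<Sum>j\<in>UNIV. v j * dv j i) + dp i = 0) \<longrightarrow>
     pt + (\<Sum>j\<in>UNIV. v j * dp j) + \<gamma> * pr * (\<Sum>j\<in>UNIV. dv j j) = 0 \<longrightarrow>
     rt + (\<Sum>j\<in>UNIV. v j * dr j) + r * (\<Sum>j\<in>UNIV. dv j j) = 0 \<longrightarrow>
     \<bar>r\<bar> \<le> M \<longrightarrow> (\<forall>i. \<bar>vt i\<bar> \<le> M) \<longrightarrow> (\<forall>j i. \<bar>dv j i\<bar> \<le> M) \<longrightarrow> (\<forall>j. \<bar>dp j\<bar> \<le> M) \<longrightarrow> (\<forall>j. \<bar>dr j\<bar> \<le> M) \<longrightarrow>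
     P = pr - pb \<longrightarrow> q = P - s2 * (r - rb) \<longrightarrow>
     (\<Sum>i\<in>UNIV. v i * (rb * vt i + dp i)) + P / a * (pt + a * (\<Sum>j\<in>UNIV. dv j j)) + q * (pt - s2 * rt)
       \<le> B * ((rb * (\<Sum>i\<in>UNIV. v i * v i) + P * P / a + q * q) / 2)"
    using perturbation_energy_rate[OF gamma bg(1) s2(1) M(1) a_def a s2(2), where 'n = 'n] by blast
  have pointwise: "pd_t (h u) (x, t) + (\<Sum>j\<in>UNIV. pd_x j (h (F j)) (x, t)) \<le> B * h u (x, t)"
    if tI: "t \<in> I" for x t
  proof (cases "x \<in> cball c m")
    case False
    have z: "(x, t) \<in> (- cball c m) \<times> I" "open ((- cball c m) \<times> I)"
      using False tI oW by (auto intro: open_Times)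
    have "dirderiv v (h u) (x, t) = dirderiv v (\<lambda>z. 0) (x, t)" for v
      by (rule dirderiv_cong_open[OF z(2) z(1)]) (use hu_supp I_sub in auto)
    moreover have "dirderiv v (h (F j)) (x, t) = dirderiv v (\<lambda>z. 0) (x, t)" for v j
      by (rule dirderiv_cong_open[OF z(2) z(1)]) (use hF_supp I_sub in auto)
    ultimately show ?thesis
      using hu_supp[OF I_sub[OF tI] False] by (simp add: pd_t_eq_dirderiv pd_x_eq_dirderiv)
  next
    case True
    define z where "z = (x, t)"
    have zW: "z \<in> W" using True X(2) tI by (auto simp: z_def W_def)
    have zi: "z \<in> interior \<Omega>" using zW Wi by blast
    have zK: "z \<in> K \<inter> interior \<Omega>" using zi True I_sub[OF tI] by (auto simp: K_def z_def)
    have e1: "pd_t (h u) z = pd_t u z" "pd_x j (h (F j)) z = pd_x j (F j) z" for j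
      unfolding pd_t_eq_dirderiv pd_x_eq_dirderiv
      by (rule dirderiv_cong_open[OF oW(2) zW]; auto simp: W_def h_def)+
    note d = differentiable[OF zi]
    have dP: "P differentiable (at z)" "q differentiable (at z)" "E differentiable (at z)" "\<eta> differentiable (at z)"
      using PC qC EC \<eta>C zW by (auto intro: C1_open_differentiable)
    have Pt: "pd_t P z = pd_t p z" "pd_x j P z = pd_x j p z" for j
      unfolding P_def using d by (auto simp: pd_t_rules pd_x_rules)
    have qt: "pd_t q z = pd_t p z - s2 * pd_t \<rho> z"
      unfolding q_def using d dP by (simp add: pd_t_rules Pt)
    have Et: "pd_t E z = rb * (\<Sum>i\<in>UNIV. V z $ i * pd_t (\<lambda>z. V z $ i) z) + P z / a * pd_t p z + q z * pd_t q z"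
    proof -
      have "pd_t E z = hf * (rb * (\<Sum>i\<in>UNIV. V z $ i * pd_t (\<lambda>z. V z $ i) z + pd_t (\<lambda>z. V z $ i) z * V z $ i)
         + ia * (P z * pd_t p z + pd_t p z * P z) + (q z * pd_t q z + pd_t q z * q z))"
        unfolding E_def using d dP by (simp add: pd_t_rules Pt)
      also have "(\<Sum>i\<in>UNIV. V z $ i * pd_t (\<lambda>z. V z $ i) z + pd_t (\<lambda>z. V z $ i) z * V z $ i)
          = 2 * (\<Sum>i\<in>UNIV. V z $ i * pd_t (\<lambda>z. V z $ i) z)"
        by (simp add: sum_distrib_left mult.commute)
      finally show ?thesis using a by (simp add: hf_def ia_def field_simps)
    qed
    have ut: "pd_t u z = E z * (- (\<sigma> * \<psi> z)) + pd_t E z * \<eta> z"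
      unfolding u_def using dP by (simp add: pd_t_rules \<eta>(5))
    have Fx: "pd_x j (F j) z = - \<psi> z * P z * (V z $ j * w z $ j)
       + \<eta> z * (P z * pd_x j (\<lambda>z. V z $ j) z + V z $ j * pd_x j p z)" for j
      unfolding F_def using d dP by (simp add: pd_x_rules \<eta>(6) Pt algebra_simps)
    have sFx: "(\<Sum>j\<in>UNIV. pd_x j (F j) z) = - \<psi> z * (P z * (V z \<bullet> w z)) + \<eta> z * (P z * (\<Sum>j\<in>UNIV. pd_x j (\<lambda>z. V z $ j) z)
        + (\<Sum>j\<in>UNIV. V z $ j * pd_x j p z))"
      unfolding Fx inner_vec_def
      by (simp add: sum.distrib sum_subtractf sum_negf sum_distrib_left mult.assoc distrib_left)
    have rate: "(\<Sum>i\<in>UNIV. V z $ i * (rb * pd_t (\<lambda>z. V z $ i) z + pd_x i p z))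
        + P z / a * (pd_t p z + a * (\<Sum>j\<in>UNIV. pd_x j (\<lambda>z. V z $ j) z)) + q z * (pd_t p z - s2 * pd_t \<rho> z)
        \<le> B * ((rb * (\<Sum>i\<in>UNIV. V z $ i * V z $ i) + P z * P z / a + q z * q z) / 2)"
    proof (rule B(2)[rule_format, where r = "\<rho> z" and pr = "p z" and dr = "\<lambda>j. pd_x j \<rho> z"
          and dv = "\<lambda>j i. pd_x j (\<lambda>z. V z $ i) z"])
      show "\<bar>\<rho> z\<bar> \<le> M" using M(2) zK by blast
      have n1: "norm (0 :: real^'n, 1 :: real) = 1" by (simp add: norm_Pair)
      show "\<bar>pd_t (\<lambda>z. V z $ i) z\<bar> \<le> M" for i
        using M(3)[OF zK n1] by (simp add: pd_t_eq_dirderiv)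
      show "\<bar>pd_x j (\<lambda>z. V z $ i) z\<bar> \<le> M" "\<bar>pd_x j p z\<bar> \<le> M" "\<bar>pd_x j \<rho> z\<bar> \<le> M" for j i
        using M(3)[OF zK norm_axis_Pair[of j]] by (simp_all add: pd_x_eq_dirderiv)
      show "P z = p z - pb" by (simp add: P_def)
      show "q z = P z - s2 * (\<rho> z - rb)" by (simp add: q_def)
    qed (use momentum_equation[OF zi] pressure_equation[OF zi] mass_equation[OF zi] in simp_all)
    have Ez: "(rb * (\<Sum>i\<in>UNIV. V z $ i * V z $ i) + P z * P z / a + q z * q z) / 2 = E z"
      by (simp add: E_def hf_def ia_def)
    have flux: "\<bar>P z * (V z \<bullet> w z)\<bar> \<le> \<sigma> * E z"
    proof -
      have "\<bar>P z * (V z \<bullet> w z)\<bar> \<le> \<sigma> * ((rb * (V z \<bullet> V z) + P z * P z / a) / 2)"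
        by (rule acoustic_flux_bound) (use bg a \<sigma> \<eta>(4) in \<open>auto simp: a_def\<close>)
      also have "\<dots> \<le> \<sigma> * E z"
        using \<sigma>0 unfolding Ez[symmetric] by (simp add: inner_vec_def)
      finally show ?thesis .
    qed
    have "pd_t u z + (\<Sum>j\<in>UNIV. pd_x j (F j) z) =
      - \<psi> z * (\<sigma> * E z + P z * (V z \<bullet> w z)) + \<eta> z * ((\<Sum>i\<in>UNIV. V z $ i * (rb * pd_t (\<lambda>z. V z $ i) z + pd_x i p z))
        + P z / a * (pd_t p z + a * (\<Sum>j\<in>UNIV. pd_x j (\<lambda>z. V z $ j) z)) + q z * (pd_t p z - s2 * pd_t \<rho> z))"
    proof -
      have "(\<Sum>i\<in>UNIV. V z $ i * (rb * pd_t (\<lambda>z. V z $ i) z + pd_x i p z)) =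
          rb * (\<Sum>i\<in>UNIV. V z $ i * pd_t (\<lambda>z. V z $ i) z) + (\<Sum>j\<in>UNIV. V z $ j * pd_x j p z)"
        by (simp add: sum.distrib sum_distrib_left distrib_left mult.left_commute)
      moreover have "P z / a * (pd_t p z + a * (\<Sum>j\<in>UNIV. pd_x j (\<lambda>z. V z $ j) z)) =
         P z / a * pd_t p z + P z * (\<Sum>j\<in>UNIV. pd_x j (\<lambda>z. V z $ j) z)" using a by (simp add: field_simps)
      ultimately show ?thesis unfolding ut sFx Et qt by (simp add: algebra_simps)
    qed
    also have "\<dots> \<le> 0 + \<eta> z * (B * E z)"
    proof (rule add_mono)
      show "- \<psi> z * (\<sigma> * E z + P z * (V z \<bullet> w z)) \<le> 0"
        using flux \<eta>(3)[of z] by (simp add: mult_nonneg_nonneg)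
    qed (rule mult_left_mono[OF rate[unfolded Ez] \<eta>(2)])
    also have "\<dots> = B * h u z" using zW by (auto simp: W_def h_def u_def)
    finally show ?thesis unfolding e1(1)[symmetric] e1(2)[symmetric] unfolding z_def .
  qed
  define y where "y = (\<lambda>t. LINT x|lborel. h u (x, t))"
  have y_deriv: "\<exists>y'. (y has_real_derivative y') (at t) \<and> y' \<le> B * y t" if t: "t0 < t" "t < t1" for t
  proof -
    have tI: "t \<in> I" using t by (simp add: I_def)
    have s1: "\<And>x t. t \<in> I \<Longrightarrow> x \<notin> cball c m \<Longrightarrow> h u (x, t) = 0"
      and s2: "\<And>x t j. t \<in> I \<Longrightarrow> x \<notin> cball c m \<Longrightarrow> h (F j) (x, t) = 0"
      using hu_supp hF_supp I_sub by blast+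
    note bl = balance_law[of I t "h u" "\<lambda>j. h (F j)" c m, OF oW(1) tI huC hFC s1 s2]
    have i: "integrable lborel (\<lambda>x. h u (x, t))"
      by (rule integrable_compact_support[OF continuous_on_slice[OF C1_open_continuous[OF huC] tI] s1[OF tI]])
    have "(LINT x|lborel. pd_t (h u) (x, t) + (\<Sum>j\<in>UNIV. pd_x j (h (F j)) (x, t)))
        \<le> (LINT x|lborel. B * h u (x, t))"
      by (rule integral_mono) (use bl(2) i pointwise[OF tI] in auto)
    then show ?thesis using bl(1) by (auto simp: y_def)
  qed
  have "y t1 = 0"
  proof (rule gronwall_zero[OF _ t(1) y_deriv])
    show "continuous_on {t0..t1} y"
      unfolding y_def by (rule continuous_on_integral_compact_support[OF cont hu_supp])
    have "h u (x, t0) = 0" for x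
    proof (cases "x \<in> ball c m")
      case True
      then show ?thesis using init[OF True] by (simp add: h_def u_def E_def P_def q_def)
    qed (simp add: h_def u_def \<eta>(7))
    then show "y t0 = 0" by (simp add: y_def)
    show "0 \<le> y t1"
      unfolding y_def by (rule integral_nonneg_AE) (simp add: h_def u_def E0 \<eta>(2))
  qed
  have t1: "t1 \<in> {t0..t1}" using t by simp
  have "h u (c, t1) = 0"
    by (rule integral_compact_support_eq_0D[OF continuous_on_slice[OF cont t1] hu_supp[OF t1]])
      (use \<open>y t1 = 0\<close> in \<open>simp_all add: y_def h_def u_def E0 \<eta>(2)\<close>)
  moreover have "c \<in> X" "\<eta> (c, t1) > 0"
  proof -
    have "0 \<le> m" using t \<sigma>0 by (smt (verit) mult_nonneg_nonneg)
    then show "c \<in> X" using X by auto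
  qed (rule \<eta>(8)[OF e(2)])
  ultimately have "E (c, t1) = 0" by (simp add: h_def u_def)
  then have s: "rb * (\<Sum>i\<in>UNIV. V (c, t1) $ i * V (c, t1) $ i) + (1 / a) * (P (c, t1) * P (c, t1)) + q (c, t1) * q (c, t1) = 0"
    by (simp add: E_def hf_def ia_def)
  have nn: "0 \<le> rb * (\<Sum>i\<in>UNIV. V (c, t1) $ i * V (c, t1) $ i)" "0 \<le> (1 / a) * (P (c, t1) * P (c, t1))" "0 \<le> q (c, t1) * q (c, t1)"
    using bg a sumV0 by simp_all
  with s have z: "rb * (\<Sum>i\<in>UNIV. V (c, t1) $ i * V (c, t1) $ i) = 0" "(1 / a) * (P (c, t1) * P (c, t1)) = 0" "q (c, t1) * q (c, t1) = 0"
    by linarith+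
  from z(1) have "V (c, t1) $ i = 0" for i
    using bg by (simp add: sum_nonneg_eq_0_iff)
  moreover from z(2) have "P (c, t1) = 0" using a by simp
  moreover from z(3) this have "\<rho> (c, t1) = rb" using s2 by (simp add: q_def)
  ultimately show ?thesis by (simp add: P_def vec_eq_iff)
qed

end

section \<open>Conservation of energy and the virial inequality\<close>

text \<open>
Integrate the differential inequality for \<open>H\<close>, then the equation for \<open>G\<close>.
\<close>

lemma quadratic_upper_bound:
  fixes G H :: "real \<Rightarrow> real"
  assumes G: "continuous_on {0..<T} G" "\<And>t. 0 < t \<Longrightarrow> t < T \<Longrightarrow> (G has_real_derivative - (2 * B * H t)) (at t)"
    and H: "continuous_on {0..<T} H" "\<And>t. 0 < t \<Longrightarrow> t < T \<Longrightarrow> \<exists>h\<ge>N. (H has_real_derivative h) (at t)"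
    and B: "B \<ge> 0" and t: "t \<in> {0..<T}"
  shows "G t \<le> G 0 - 2 * B * H 0 * t - B * N * t\<^sup>2"
proof -
  have Hge: "H s \<ge> H 0 + N * s" if s: "s \<in> {0..<T}" for s
  proof -
    have "H 0 - N * 0 \<le> H s - N * s"
    proof (rule DERIV_nonneg_imp_increasing_open[where f = "\<lambda>s. H s - N * s"])
      show "0 \<le> s" using s by simp
      show "continuous_on {0..s} (\<lambda>s. H s - N * s)"
        by (intro continuous_intros continuous_on_subset[OF H(1)]) (use s in auto)
      fix x assume x: "0 < x" "x < s"
      obtain h where h: "h \<ge> N" "(H has_real_derivative h) (at x)" using H(2)[of x] x s by auto
      then have "((\<lambda>s. H s - N * s) has_real_derivative h - N) (at x)"
        by (auto intro!: derivative_eq_intros)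
      then show "\<exists>y. ((\<lambda>s. H s - N * s) has_real_derivative y) (at x) \<and> 0 \<le> y"
        using h(1) by (intro exI[of _ "h - N"]) simp
    qed
    then show ?thesis by simp
  qed
  let ?g = "\<lambda>s. G s + 2 * B * H 0 * s + B * N * s\<^sup>2"
  have "?g t \<le> ?g 0"
  proof (rule DERIV_nonpos_imp_decreasing_open[where f = ?g])
    show "0 \<le> t" using t by simp
    show "continuous_on {0..t} ?g"
      by (intro continuous_intros continuous_on_subset[OF G(1)]) (use t in auto)
    fix x assume x: "0 < x" "x < t"
    have "(?g has_real_derivative - (2 * B * H x) + 2 * B * H 0 + B * N * (2 * x)) (at x)"
      using G(2)[of x] x t by (auto intro!: derivative_eq_intros)
    moreover have "- (2 * B * H x) + 2 * B * H 0 + B * N * (2 * x) \<le> 0"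
    proof -
      have "2 * B * (H 0 + N * x) \<le> 2 * B * H x"
        using Hge[of x] x t B by (intro mult_left_mono) auto
      then show ?thesis by (simp add: algebra_simps)
    qed
    ultimately show "\<exists>y. (?g has_real_derivative y) (at x) \<and> y \<le> 0" by blast
  qed
  then show ?thesis by simp
qed

text \<open>
Here \<open>a\<close> is the kinetic energy, \<open>b\<close> the excess of internal energy, and \<open>m\<close> the background pressure
times the volume, which bounds the total pressure deficit. If \<open>n * (\<gamma> - 1) \<le> 2\<close>, then
\<open>\<delta> = n * (\<gamma> - 1)\<close>, the second summand vanishes and the bound is \<open>n * (\<gamma> - 1) * a \<le> 2 * a\<close>.
Otherwise \<open>\<delta> = 2\<close>, and a nonnegative multiple of \<open>b\<close> remains, which is bounded below by the deficit.
\<close>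

lemma virial_coefficient_bound:
  fixes a b \<gamma> n \<delta> m :: real
  assumes "\<gamma> > 1" "n \<ge> 0" and \<delta>: "\<delta> = min 2 (n * (\<gamma> - 1))" and a: "a \<ge> 0" and b: "(\<gamma> - 1) * b \<ge> - m" "m \<ge> 0"
  shows "\<delta> * (a + b) + m * (\<delta> / (\<gamma> - 1) - n) \<le> 2 * a + n * ((\<gamma> - 1) * b)"
proof (cases "n * (\<gamma> - 1) \<le> 2")
  case True
  then have d: "\<delta> = n * (\<gamma> - 1)" using \<delta> by simp
  have "\<delta> / (\<gamma> - 1) - n = 0" using assms(1) d by simp
  moreover have "n * (\<gamma> - 1) * a \<le> 2 * a" using True a by (rule mult_right_mono)
  ultimately show ?thesis by (simp add: d algebra_simps)
next
  case False
  then have d: "\<delta> = 2" using \<delta> by simp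
  define c where "c = n - 2 / (\<gamma> - 1)"
  have c: "c \<ge> 0" "c * (\<gamma> - 1) = n * (\<gamma> - 1) - 2" using False assms(1) by (auto simp: c_def field_simps)
  have "c * (- m) \<le> c * ((\<gamma> - 1) * b)" using b(1) c(1) by (rule mult_left_mono)
  also have "\<dots> = n * ((\<gamma> - 1) * b) - 2 * b" using c(2) by (metis left_diff_distrib mult.assoc)
  finally show ?thesis by (simp add: d c_def algebra_simps)
qed

lemma inner_self_eq_sum: "x \<bullet> x = (\<Sum>i\<in>UNIV. x $ i * x $ i)" for x :: "real^'n"
  by (simp add: inner_vec_def)

context euler_flow
begin

context
  fixes T r rb pb :: real
  assumes domain: "UNIV \<times> {0..<T} \<subseteq> \<Omega>"
    and outside: "\<And>x t. t \<in> {0..<T} \<Longrightarrow> x \<notin> cball 0 r \<Longrightarrow> V (x, t) = 0 \<and> \<rho> (x, t) = rb \<and> p (x, t) = pb"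
begin

lemma slab_subset_interior: "UNIV \<times> {0<..<T} \<subseteq> interior \<Omega>"
  by (rule interior_maximal) (use domain in \<open>auto intro: open_Times\<close>)

lemmas C1_open_slab = C1_open[THEN C1_open_subset, OF slab_subset_interior]

lemmas continuous_slab = C1[THEN C1_on_continuous, THEN continuous_on_subset, OF domain]

lemma continuous_V_slab: "continuous_on (UNIV \<times> {0..<T}) V"
  using solution C1_on_continuous[THEN continuous_on_subset, OF _ domain]
  by (auto simp: euler_solution_def)

text \<open>
The energy density is normalised by the background pressure so that it has compact support. With the
flux \<open>(\<rho> * (V \<bullet> V) / 2 + \<gamma> / (\<gamma> - 1) * p) * V\<close> its balance is a combination of the mass, momentum and
pressure equations.
\<close>

lemma energy_conserved:
  assumes t: "t \<in> {0..<T}"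
  defines "u \<equiv> (\<lambda>z. (1 / 2) * (\<rho> z * (V z \<bullet> V z)) + (1 / (\<gamma> - 1)) * (p z - pb))"
  shows "(LINT x|lborel. u (x, t)) = (LINT x|lborel. u (x, 0))"
proof -
  \<comment> \<open>As named constants the factors stay products, to which the product rule applies.\<close>
  define hf c1 c2 where "hf = (1 / 2 :: real)" and "c1 = 1 / (\<gamma> - 1)" and "c2 = \<gamma> / (\<gamma> - 1)"
  have c: "c2 = c1 + 1" "c2 = c1 * \<gamma>" using gamma by (auto simp: c1_def c2_def field_simps)
  define Q where "Q = (\<lambda>z. \<Sum>i\<in>UNIV. V z $ i * V z $ i)"
  define F where "F = (\<lambda>j z. (hf * (\<rho> z * Q z) + c2 * p z) * V z $ j)"
  have u: "u = (\<lambda>z. hf * (\<rho> z * Q z) + c1 * (p z - pb))"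
    by (simp add: u_def hf_def c1_def Q_def inner_self_eq_sum)
  let ?W = "UNIV \<times> {0<..<T}"
  have QC: "C1_open ?W Q" unfolding Q_def by (intro C1_open_intros C1_open_slab)
  have uC: "C1_open ?W u" unfolding u by (intro C1_open_intros C1_open_slab QC)
  have FC: "C1_open ?W (F j)" for j unfolding F_def by (intro C1_open_intros C1_open_slab QC)
  have supp: "u (x, s) = 0" if "s \<in> {0..<T}" "x \<notin> cball 0 r" for x s
    using outside[OF that] by (simp add: u_def)
  have suppF: "F j (x, s) = 0" if "s \<in> {0..<T}" "x \<notin> cball 0 r" for x s j
    using outside[OF that] by (simp add: F_def)
  have zero: "pd_t u z + (\<Sum>j\<in>UNIV. pd_x j (F j) z) = 0" if z: "z \<in> ?W" for z
  proof -
    have zi: "z \<in> interior \<Omega>" using z slab_subset_interior by blast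
    note d = differentiable[OF zi] C1_open_differentiable[OF QC z]
    have Qt: "pd_t Q z = 2 * (\<Sum>i\<in>UNIV. V z $ i * pd_t (\<lambda>z. V z $ i) z)"
      unfolding Q_def using d by (simp add: pd_t_rules sum_distrib_left mult.commute)
    have Qx: "pd_x j Q z = 2 * (\<Sum>i\<in>UNIV. V z $ i * pd_x j (\<lambda>z. V z $ i) z)" for j
      unfolding Q_def using d by (simp add: pd_x_rules sum_distrib_left mult.commute)
    have ut: "pd_t u z = hf * (\<rho> z * pd_t Q z + pd_t \<rho> z * Q z) + c1 * pd_t p z"
      unfolding u using d by (simp add: pd_t_rules)
    have Fx: "pd_x j (F j) z = (hf * \<rho> z * Q z + c2 * p z) * pd_x j (\<lambda>z. V z $ j) z
        + hf * \<rho> z * (V z $ j * pd_x j Q z) + hf * Q z * (V z $ j * pd_x j \<rho> z) + c2 * (V z $ j * pd_x j p z)" for j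
      unfolding F_def using d by (simp add: pd_x_rules algebra_simps)
    have VQ: "(\<Sum>j\<in>UNIV. V z $ j * pd_x j Q z) =
        2 * (\<Sum>i\<in>UNIV. V z $ i * (\<Sum>j\<in>UNIV. V z $ j * pd_x j (\<lambda>z. V z $ i) z))"
      unfolding Qx sum_distrib_left by (subst sum.swap) (simp add: mult_ac)
    have mom: "\<rho> z * (\<Sum>i\<in>UNIV. V z $ i * pd_t (\<lambda>z. V z $ i) z)
        + \<rho> z * (\<Sum>i\<in>UNIV. V z $ i * (\<Sum>j\<in>UNIV. V z $ j * pd_x j (\<lambda>z. V z $ i) z))
        + (\<Sum>i\<in>UNIV. V z $ i * pd_x i p z) = 0"
    proof -
      have "(\<Sum>i\<in>UNIV. V z $ i * (\<rho> z * pd_t (\<lambda>z. V z $ i) z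
          + \<rho> z * (\<Sum>j\<in>UNIV. V z $ j * pd_x j (\<lambda>z. V z $ i) z) + pd_x i p z)) = 0"
        using momentum_equation[OF zi] by simp
      then show ?thesis
        unfolding distrib_left sum.distrib mult.left_commute[of _ "\<rho> z"] sum_distrib_left[of "\<rho> z", symmetric] .
    qed
    have s: "(\<Sum>j\<in>UNIV. pd_x j (F j) z) = (hf * \<rho> z * Q z + c2 * p z) * (\<Sum>j\<in>UNIV. pd_x j (\<lambda>z. V z $ j) z)
        + hf * \<rho> z * (\<Sum>j\<in>UNIV. V z $ j * pd_x j Q z) + hf * Q z * (\<Sum>j\<in>UNIV. V z $ j * pd_x j \<rho> z)
        + c2 * (\<Sum>j\<in>UNIV. V z $ j * pd_x j p z)"
      unfolding Fx sum.distrib sum_distrib_left[symmetric] ..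
    define S1 S2 S3 S4 S5 where S: "S1 = (\<Sum>i\<in>UNIV. V z $ i * pd_t (\<lambda>z. V z $ i) z)"
      "S2 = (\<Sum>i\<in>UNIV. V z $ i * (\<Sum>j\<in>UNIV. V z $ j * pd_x j (\<lambda>z. V z $ i) z))"
      "S3 = (\<Sum>j\<in>UNIV. V z $ j * pd_x j p z)" "S4 = (\<Sum>j\<in>UNIV. V z $ j * pd_x j \<rho> z)"
      "S5 = (\<Sum>j\<in>UNIV. pd_x j (\<lambda>z. V z $ j) z)"
    have h2: "hf * 2 = 1" by (simp add: hf_def)
    have "pd_t u z + (\<Sum>j\<in>UNIV. pd_x j (F j) z) =
      hf * (\<rho> z * (2 * S1) + pd_t \<rho> z * Q z) + c1 * pd_t p z +
      ((hf * \<rho> z * Q z + c2 * p z) * S5 + hf * \<rho> z * (2 * S2) + hf * Q z * S4 + c2 * S3)"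
      unfolding ut s Qt VQ S ..
    also have "\<dots> = hf * Q z * (pd_t \<rho> z + S4 + \<rho> z * S5) + (hf * 2) * (\<rho> z * S1 + \<rho> z * S2) + S3
       + c1 * (pd_t p z + S3 + \<gamma> * p z * S5) + (c2 - c1 - 1) * S3 + (c2 - c1 * \<gamma>) * (p z * S5)"
      by (simp add: algebra_simps)
    also have "\<dots> = 0"
      using mass_equation[OF zi] pressure_equation[OF zi] mom c unfolding h2 S by simp
    finally show ?thesis .
  qed
  let ?y = "\<lambda>t. LINT x|lborel. u (x, t)"
  have deriv: "(?y has_real_derivative 0) (at s)" if s: "0 < s" "s < t" for s
  proof -
    have sT: "s \<in> {0<..<T}" using s t by simp
    have "(?y has_real_derivative (LINT x|lborel. pd_t u (x, s) + (\<Sum>j\<in>UNIV. pd_x j (F j) (x, s)))) (at s)"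
      by (rule balance_law(1)[OF _ sT uC FC, of 0 r]) (use supp suppF in auto)
    then show ?thesis using zero sT by simp
  qed
  have cont: "continuous_on {0..<T} ?y"
  proof (rule continuous_on_integral_compact_support)
    show "continuous_on (UNIV \<times> {0..<T}) u"
      unfolding u_def by (intro continuous_intros continuous_slab continuous_V_slab)
  qed (rule supp)
  show ?thesis
  proof (cases "t = 0")
    case False
    then have "0 < t" using t by simp
    have "{0..t} \<subseteq> {0..<T}" using t by auto
    from DERIV_isconst2[of 0 t ?y t, OF \<open>0 < t\<close> continuous_on_subset[OF cont this] deriv]
    show ?thesis using \<open>0 < t\<close> by simp
  qed simp
qed

text \<open>
The first time derivative of the weighted mass is \<open>- 2 * B\<close> times the radial momentum, the integral of
\<open>\<rho> * (x \<bullet> V)\<close>. The derivative of the radial momentum is the integral of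
\<open>\<rho> * (V \<bullet> V) + n * (p - pb)\<close>, which is at least \<open>N\<close> by conservation of energy. Both follow from the
balance law, with the density and the pressure normalised to compact support.
\<close>

lemma virial_upper_bound:
  fixes \<delta> n e0 N B :: real
  assumes pb: "pb \<ge> 0" and n: "n = real CARD('n)" and \<delta>: "\<delta> = min 2 (n * (\<gamma> - 1))"
    and e0: "e0 = (1 / 2) * (LINT x|lborel. \<rho> (x, 0) * (V (x, 0) \<bullet> V (x, 0)))
       + (1 / (\<gamma> - 1)) * (LINT x|lborel. p (x, 0) - pb)"
    and N: "N = \<delta> * e0 + measure lborel (cball (0 :: real^'n) r) * pb * (\<delta> / (\<gamma> - 1) - n)"
    and B: "B \<ge> 0" and t: "t \<in> {0..<T}"
  shows "(LINT x|lborel. (\<rho> (x, t) - rb) * (1 - B * (x \<bullet> x))) \<le>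
    (LINT x|lborel. (\<rho> (x, 0) - rb) * (1 - B * (x \<bullet> x)))
     - 2 * B * (LINT x|lborel. \<rho> (x, 0) * (x \<bullet> V (x, 0))) * t - B * N * t\<^sup>2"
proof -
  let ?W = "UNIV \<times> {0<..<T}"
  define P where "P = (\<lambda>z. p z - pb)"
  define Q where "Q = (\<lambda>z. \<Sum>i\<in>UNIV. V z $ i * V z $ i)"
  define X where "X = (\<lambda>z :: (real^'n) \<times> real. 1 - B * (\<Sum>i\<in>UNIV. fst z $ i * fst z $ i))"
  \<comment> \<open>\<open>u\<close> and \<open>F\<close> are the weighted mass and its flux, \<open>m\<close> and \<open>E\<close> the radial momentum and its flux.\<close>
  define u where "u = (\<lambda>z. (\<rho> z - rb) * X z)"
  define F where "F = (\<lambda>j z. \<rho> z * V z $ j * X z)"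
  define m where "m = (\<lambda>z. \<Sum>i\<in>UNIV. fst z $ i * (\<rho> z * V z $ i))"
  define E where "E = (\<lambda>j z. (\<Sum>i\<in>UNIV. fst z $ i * (\<rho> z * V z $ i * V z $ j)) + fst z $ j * P z)"
  have PC: "C1_open ?W P" unfolding P_def by (intro C1_open_intros C1_open_slab)
  have XC: "C1_open ?W X" unfolding X_def by (intro C1_open_intros C1_open_fst)
  have uC: "C1_open ?W u" unfolding u_def by (intro C1_open_intros C1_open_slab XC)
  have FC: "C1_open ?W (F j)" for j unfolding F_def by (intro C1_open_intros C1_open_slab XC)
  have mC: "C1_open ?W m" unfolding m_def by (intro C1_open_intros C1_open_slab C1_open_fst)
  have EC: "C1_open ?W (E j)" for j unfolding E_def by (intro C1_open_intros C1_open_slab C1_open_fst PC)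
  have supp: "u (x, s) = 0" "F j (x, s) = 0" "m (x, s) = 0" "E j (x, s) = 0"
    if "s \<in> {0..<T}" "x \<notin> cball 0 r" for x s j
    using outside[OF that] by (auto simp: u_def F_def m_def E_def P_def)
  have d: "(\<lambda>z. fst z $ i) differentiable (at z)" for z :: "(real^'n) \<times> real" and i
    using C1_open_differentiable[OF C1_open_fst[of UNIV]] by simp
  have eq1: "pd_t u z + (\<Sum>j\<in>UNIV. pd_x j (F j) z) = - (2 * B) * m z" if z: "z \<in> ?W" for z
  proof -
    have zi: "z \<in> interior \<Omega>" using z slab_subset_interior by blast
    note d = differentiable[OF zi] C1_open_differentiable[OF XC z] d
    have Xt: "pd_t X z = 0" unfolding X_def using d by (simp add: pd_t_rules pd_t_fst)
    have Xx: "pd_x j X z = - (2 * B) * fst z $ j" for j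
    proof -
      have "pd_x j (\<lambda>z. fst z $ i * fst z $ i) z = (if i = j then 2 * fst z $ j else 0)" for i
        using d by (auto simp: pd_x_rules pd_x_fst)
      then show ?thesis unfolding X_def using d by (simp add: pd_x_rules)
    qed
    have ut: "pd_t u z = pd_t \<rho> z * X z" unfolding u_def using d by (simp add: pd_t_rules Xt)
    have Fx: "pd_x j (F j) z = X z * (V z $ j * pd_x j \<rho> z + \<rho> z * pd_x j (\<lambda>z. V z $ j) z)
      + (- (2 * B)) * (fst z $ j * (\<rho> z * V z $ j))" for j
      unfolding F_def using d by (simp add: pd_x_rules Xx algebra_simps)
    have "pd_t u z + (\<Sum>j\<in>UNIV. pd_x j (F j) z) = X z * (pd_t \<rho> z + (\<Sum>j\<in>UNIV. V z $ j * pd_x j \<rho> z)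
       + \<rho> z * (\<Sum>j\<in>UNIV. pd_x j (\<lambda>z. V z $ j) z)) + (- (2 * B)) * m z"
      unfolding ut Fx sum.distrib sum_distrib_left[symmetric] m_def by (simp add: algebra_simps)
    then show ?thesis using mass_equation[OF zi] by simp
  qed
  have eq2: "pd_t m z + (\<Sum>j\<in>UNIV. pd_x j (E j) z) = \<rho> z * (V z \<bullet> V z) + n * P z" if z: "z \<in> ?W" for z
  proof -
    have zi: "z \<in> interior \<Omega>" using z slab_subset_interior by blast
    note d = differentiable[OF zi] C1_open_differentiable[OF PC z] d
    have mt: "pd_t m z = (\<Sum>i\<in>UNIV. fst z $ i * pd_t (\<lambda>z. \<rho> z * V z $ i) z)"
      unfolding m_def using d by (simp add: pd_t_rules pd_t_fst)
    have Px: "pd_x j P z = pd_x j p z" for j unfolding P_def using d by (simp add: pd_x_rules)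
    have t: "pd_x j (\<lambda>z. fst z $ i * (\<rho> z * V z $ i * V z $ j)) z =
        fst z $ i * pd_x j (\<lambda>z. \<rho> z * V z $ i * V z $ j) z + (if i = j then \<rho> z * V z $ j * V z $ j else 0)" for i j
      using d by (auto simp: pd_x_rules pd_x_fst)
    have Ex: "pd_x j (E j) z = (\<Sum>i\<in>UNIV. fst z $ i * pd_x j (\<lambda>z. \<rho> z * V z $ i * V z $ j) z)
        + \<rho> z * V z $ j * V z $ j + fst z $ j * pd_x j p z + P z" for j
    proof -
      have "pd_x j (E j) z = (\<Sum>i\<in>UNIV. pd_x j (\<lambda>z. fst z $ i * (\<rho> z * V z $ i * V z $ j)) z)
          + (fst z $ j * pd_x j p z + P z)"
        unfolding E_def using d by (simp add: pd_x_rules pd_x_fst Px differentiable_sum_any)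
      then show ?thesis unfolding t by (simp add: sum.distrib)
    qed
    have "(\<Sum>j\<in>UNIV. pd_x j (E j) z) = (\<Sum>i\<in>UNIV. fst z $ i * (\<Sum>j\<in>UNIV. pd_x j (\<lambda>z. \<rho> z * V z $ i * V z $ j) z))
        + \<rho> z * (V z \<bullet> V z) + (\<Sum>i\<in>UNIV. fst z $ i * pd_x i p z) + n * P z"
    proof -
      have "(\<Sum>j\<in>UNIV. \<Sum>i\<in>UNIV. fst z $ i * pd_x j (\<lambda>z. \<rho> z * V z $ i * V z $ j) z) =
        (\<Sum>i\<in>UNIV. fst z $ i * (\<Sum>j\<in>UNIV. pd_x j (\<lambda>z. \<rho> z * V z $ i * V z $ j) z))"
        unfolding sum_distrib_left by (rule sum.swap)
      then show ?thesis
        unfolding Ex sum.distrib by (simp add: n inner_self_eq_sum sum_distrib_left mult.assoc)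
    qed
    then have "pd_t m z + (\<Sum>j\<in>UNIV. pd_x j (E j) z) = (\<Sum>i\<in>UNIV. fst z $ i * (pd_t (\<lambda>z. \<rho> z * V z $ i) z
       + (\<Sum>j\<in>UNIV. pd_x j (\<lambda>z. \<rho> z * V z $ i * V z $ j) z) + pd_x i p z)) + \<rho> z * (V z \<bullet> V z) + n * P z"
      unfolding mt by (simp add: distrib_left sum.distrib)
    moreover have "pd_t (\<lambda>z. \<rho> z * V z $ i) z
       + (\<Sum>j\<in>UNIV. pd_x j (\<lambda>z. \<rho> z * V z $ i * V z $ j) z) + pd_x i p z = 0" for i
      using solution zi by (auto simp: euler_solution_def)
    ultimately show ?thesis by simp
  qed
  have cont_u: "continuous_on (UNIV \<times> {0..<T}) u" and cont_m: "continuous_on (UNIV \<times> {0..<T}) m"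
    unfolding u_def X_def m_def by (intro continuous_intros continuous_slab)+
  let ?G = "\<lambda>t. LINT x|lborel. u (x, t)" and ?H = "\<lambda>t. LINT x|lborel. m (x, t)"
  have G': "(?G has_real_derivative - (2 * B * ?H s)) (at s)" if s: "0 < s" "s < T" for s
  proof -
    have sT: "s \<in> {0<..<T}" using s by simp
    have "(?G has_real_derivative (LINT x|lborel. pd_t u (x, s) + (\<Sum>j\<in>UNIV. pd_x j (F j) (x, s)))) (at s)"
      by (rule balance_law(1)[OF _ sT uC FC, of 0 r]) (use supp in auto)
    then show ?thesis using eq1 sT by simp
  qed
  have H': "\<exists>h\<ge>N. (?H has_real_derivative h) (at s)" if s: "0 < s" "s < T" for s
  proof -
    have sT: "s \<in> {0<..<T}" "s \<in> {0..<T}" using s by auto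
    have T0: "0 \<in> {0..<T}" using s by simp
    have H: "(?H has_real_derivative (LINT x|lborel. pd_t m (x, s) + (\<Sum>j\<in>UNIV. pd_x j (E j) (x, s)))) (at s)"
      by (rule balance_law(1)[OF _ sT(1) mC EC, of 0 r]) (use supp in auto)
    have contV: "continuous_on (UNIV \<times> {0..<T}) (\<lambda>z. \<rho> z * (V z \<bullet> V z))"
      and contP: "continuous_on (UNIV \<times> {0..<T}) P"
      unfolding P_def by (intro continuous_intros continuous_slab continuous_V_slab)+
    have iV: "integrable lborel (\<lambda>x. \<rho> (x, t) * (V (x, t) \<bullet> V (x, t)))" if "t \<in> {0..<T}" for t
      by (rule integrable_compact_support[OF continuous_on_slice[OF contV that], of 0 r])
        (use outside[OF that] in auto)
    have iP: "integrable lborel (\<lambda>x. P (x, t))" if "t \<in> {0..<T}" for t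
      by (rule integrable_compact_support[OF continuous_on_slice[OF contP that], of 0 r])
        (use outside[OF that] in \<open>auto simp: P_def\<close>)
    define a b where "a = (1 / 2) * (LINT x|lborel. \<rho> (x, s) * (V (x, s) \<bullet> V (x, s)))"
      and "b = (1 / (\<gamma> - 1)) * (LINT x|lborel. P (x, s))"
    have split: "(LINT x|lborel. (1 / 2) * (\<rho> (x, t) * (V (x, t) \<bullet> V (x, t))) + (1 / (\<gamma> - 1)) * (p (x, t) - pb)) =
      (1 / 2) * (LINT x|lborel. \<rho> (x, t) * (V (x, t) \<bullet> V (x, t))) + (1 / (\<gamma> - 1)) * (LINT x|lborel. P (x, t))"
      if "t \<in> {0..<T}" for t
      using iV[OF that] iP[OF that] unfolding P_def by (subst Bochner_Integration.integral_add) auto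
    have ab: "a + b = e0"
      using energy_conserved[OF sT(2)] unfolding split[OF sT(2)] split[OF T0] a_def b_def e0
      by (simp add: P_def)
    have pos: "z \<in> UNIV \<times> {0..<T} \<Longrightarrow> \<rho> z \<ge> 0 \<and> p z \<ge> 0" for z
      using rho_nonneg p_nonneg domain by blast
    have a0: "a \<ge> 0"
      unfolding a_def using pos sT by (intro mult_nonneg_nonneg integral_nonneg_AE) auto
    have b0: "(\<gamma> - 1) * b \<ge> - (measure lborel (cball (0 :: real^'n) r) * pb)"
    proof -
      have "(LINT x|lborel. - pb * indicator (cball (0 :: real^'n) r) x) \<le> (LINT x|lborel. P (x, s))"
      proof (rule integral_mono[OF _ iP[OF sT(2)]])
        show "integrable lborel (\<lambda>x. - pb * indicator (cball (0 :: real^'n) r) x)"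
          by (intro integrable_mult_right integrable_real_indicator) (auto intro: emeasure_lborel_cball_finite[unfolded infinity_ennreal_def])
        show "- pb * indicator (cball (0 :: real^'n) r) x \<le> P (x, s)" for x
          using outside[OF sT(2), of x] pos[of "(x, s)"] sT by (auto simp: P_def indicator_def)
      qed
      then show ?thesis using gamma by (simp add: b_def mult.commute)
    qed
    have "(LINT x|lborel. pd_t m (x, s) + (\<Sum>j\<in>UNIV. pd_x j (E j) (x, s))) =
        (LINT x|lborel. \<rho> (x, s) * (V (x, s) \<bullet> V (x, s)) + n * P (x, s))"
      using eq2 sT by simp
    also have "\<dots> = 2 * a + n * ((\<gamma> - 1) * b)"
      using iV[OF sT(2)] iP[OF sT(2)] gamma by (simp add: a_def b_def)
    also have "\<dots> \<ge> \<delta> * (a + b) + measure lborel (cball (0 :: real^'n) r) * pb * (\<delta> / (\<gamma> - 1) - n)"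
      using gamma n pb by (intro virial_coefficient_bound[OF _ _ \<delta> a0 b0]) auto
    finally have "(LINT x|lborel. pd_t m (x, s) + (\<Sum>j\<in>UNIV. pd_x j (E j) (x, s))) \<ge> N"
      by (simp add: N ab)
    with H show ?thesis by blast
  qed
  have "?G t \<le> ?G 0 - 2 * B * ?H 0 * t - B * N * t\<^sup>2"
  proof (rule quadratic_upper_bound[OF _ G' _ H' B t])
    show "continuous_on {0..<T} ?G"
      by (rule continuous_on_integral_compact_support[OF cont_u]) (rule supp)
    show "continuous_on {0..<T} ?H"
      by (rule continuous_on_integral_compact_support[OF cont_m]) (rule supp)
  qed
  moreover have "u (x, s) = (\<rho> (x, s) - rb) * (1 - B * (x \<bullet> x))" for x s
    by (simp add: u_def X_def inner_self_eq_sum)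
  moreover have "m (x, s) = \<rho> (x, s) * (x \<bullet> V (x, s))" for x s
    by (simp add: m_def inner_vec_def sum_distrib_left mult.left_commute)
  ultimately show ?thesis by simp
qed

end

end

section \<open>The cutoff function\<close>

lemma cutoff_inner: "r \<le> R - R / k \<Longrightarrow> cutoff R k r = 1 - cutoff_B R k * r\<^sup>2"
  by (simp add: cutoff_def)

context
  fixes R k :: real
  assumes R: "R > 0" and k: "k > 1"
begin

lemma cutoff_B_pos: "cutoff_B R k > 0"
  using R k by (simp add: cutoff_B_def)

lemma core_radius: "0 < R - R / k" "R - R / k < R"
  using R k by (auto simp: field_simps)

text \<open>
The two branches of the cutoff agree at \<open>R - R / k\<close>, and the square of the positive part of \<open>R - r\<close>
covers the outer branch and the zero branch at once.
\<close>

lemma cutoff_outer: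
  "R - R / k \<le> r \<Longrightarrow> cutoff R k r = cutoff_B R k * (k - 1) * (max 0 (R - r))\<^sup>2"
proof -
  assume r: "R - R / k \<le> r"
  show ?thesis
  proof (cases "r = R - R / k")
    case True
    have "1 - cutoff_B R k * (R - R / k)\<^sup>2 = cutoff_B R k * (k - 1) * (R / k)\<^sup>2"
      using R k by (simp add: cutoff_B_def field_simps power2_eq_square)
    then show ?thesis using True R k by (simp add: cutoff_def)
  next
    case False
    then show ?thesis using r by (auto simp: cutoff_def power2_commute max_def)
  qed
qed

lemma cutoff_eq_0: "R \<le> r \<Longrightarrow> cutoff R k r = 0"
  using cutoff_outer[of r] core_radius by simp

lemma cutoff_nonneg: "0 \<le> r \<Longrightarrow> 0 \<le> cutoff R k r"
proof (cases "r \<le> R - R / k")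
  case True
  assume "0 \<le> r"
  then have "cutoff_B R k * r\<^sup>2 \<le> cutoff_B R k * (R - R / k)\<^sup>2"
    using True cutoff_B_pos by (intro mult_left_mono power_mono) auto
  also have "\<dots> = 1 - cutoff_B R k * (k - 1) * (R / k)\<^sup>2"
    using R k by (simp add: cutoff_B_def field_simps power2_eq_square)
  also have "\<dots> \<le> 1" using cutoff_B_pos k by simp
  finally show ?thesis using True by (simp add: cutoff_inner)
next
  case False
  then show ?thesis using cutoff_outer[of r] cutoff_B_pos k by simp
qed

lemma continuous_on_cutoff: "continuous_on UNIV (cutoff R k)"
proof -
  have "continuous_on UNIV (\<lambda>r. if r \<le> R - R / k then 1 - cutoff_B R k * r\<^sup>2
      else cutoff_B R k * (k - 1) * (max 0 (R - r))\<^sup>2)"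
  proof (rule continuous_on_cases_le)
    show "1 - cutoff_B R k * r\<^sup>2 = cutoff_B R k * (k - 1) * (max 0 (R - r))\<^sup>2"
      if "r = R - R / k" for r
      using that cutoff_outer[of r] cutoff_inner[of r R k] by simp
  qed (auto intro!: continuous_intros)
  moreover have "cutoff R k = (\<lambda>r. if r \<le> R - R / k then 1 - cutoff_B R k * r\<^sup>2
      else cutoff_B R k * (k - 1) * (max 0 (R - r))\<^sup>2)"
    using cutoff_outer by (auto simp: cutoff_inner)
  ultimately show ?thesis by simp
qed

lemma deriv_cutoff_inner: "r < R - R / k \<Longrightarrow> deriv (cutoff R k) r = - (2 * cutoff_B R k * r)"
proof (rule DERIV_imp_deriv)
  assume r: "r < R - R / k"
  have "((\<lambda>r. 1 - cutoff_B R k * r\<^sup>2) has_real_derivative - (2 * cutoff_B R k * r)) (at r)"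
    by (auto intro!: derivative_eq_intros)
  then show "(cutoff R k has_real_derivative - (2 * cutoff_B R k * r)) (at r)"
    by (rule has_field_derivative_transform_within_open[OF _ open_lessThan])
      (use r in \<open>auto simp: cutoff_inner\<close>)
qed

lemma continuous_on_cutoff_norm: "continuous_on UNIV (\<lambda>x :: 'a::real_normed_vector. cutoff R k (norm x))"
  by (rule continuous_on_compose2[OF continuous_on_cutoff]) (auto intro!: continuous_intros)

lemma integrable_cutoff:
  fixes f :: "'a::euclidean_space \<Rightarrow> real"
  assumes "continuous_on UNIV f"
  shows "integrable lborel (\<lambda>x. f x * cutoff R k (norm x))"
  by (rule integrable_compact_support[of _ 0 R])
    (use cutoff_eq_0 in \<open>auto intro!: continuous_intros assms continuous_on_cutoff_norm\<close>)

text \<open>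
Since \<open>f - rb\<close> is supported in the region where the cutoff is a polynomial, the cutoff itself only
enters through a constant that is the same for all times.
\<close>

lemma G_cutoff_eq:
  fixes f :: "real^'n \<Rightarrow> real"
  assumes f: "continuous_on UNIV f" and out: "\<And>x. x \<notin> cball 0 (R - R / k) \<Longrightarrow> f x = rb"
  shows "G_cutoff R k f = (LINT x|lborel. (f x - rb) * (1 - cutoff_B R k * (x \<bullet> x)))
    + rb * (LINT x|lborel. cutoff R k (norm (x :: real^'n)))"
proof -
  have "integrable lborel (\<lambda>x. (f x - rb) * (1 - cutoff_B R k * (x \<bullet> x)))"
    by (rule integrable_compact_support[of _ 0 "R - R / k"])
      (use out in \<open>auto intro!: continuous_intros f\<close>)
  moreover have "integrable lborel (\<lambda>x :: real^'n. cutoff R k (norm x))"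
    using integrable_cutoff[OF continuous_on_const[of _ 1]] by simp
  moreover have "f x * cutoff R k (norm x) =
      (f x - rb) * (1 - cutoff_B R k * (x \<bullet> x)) + rb * cutoff R k (norm x)" for x
    using out[of x] by (cases "x \<in> cball 0 (R - R / k)")
      (auto simp: cutoff_inner power2_norm_eq_inner algebra_simps)
  ultimately show ?thesis by (simp add: G_cutoff_def)
qed

text \<open>
The bound comes from the shell between the radii \<open>R - R / k\<close> and \<open>R\<close>, where \<open>f\<close> is known to be \<open>rb\<close>. The
comparison function \<open>g\<close> is a continuous bump below \<open>rb\<close> times the cutoff, supported in this shell.
\<close>

lemma G_cutoff_lower_bound:
  assumes "rb > 0"
  shows "\<exists>c>0. \<forall>f :: real^'n \<Rightarrow> real. continuous_on UNIV f \<longrightarrow> (\<forall>x. f x \<ge> 0) \<longrightarrow>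
    (\<forall>x. x \<notin> cball 0 (R - R / k) \<longrightarrow> f x = rb) \<longrightarrow> c \<le> G_cutoff R k f"
proof -
  define r where "r = R - R / k"
  have r: "0 < r" "r < R" using core_radius by (auto simp: r_def)
  \<comment> \<open>In the shell \<open>norm x - r \<le> R\<close>, so with this factor the bump stays below \<open>rb\<close> times the cutoff.\<close>
  define K where "K = rb * (cutoff_B R k * (k - 1)) / R"
  have K: "K > 0" using assms cutoff_B_pos k R by (simp add: K_def)
  define g where "g = (\<lambda>x :: real^'n. K * (max 0 (norm x - r) * (max 0 (R - norm x))\<^sup>2))"
  have gc: "continuous_on UNIV g" unfolding g_def by (intro continuous_intros)
  have g0: "g x \<ge> 0" for x using K by (simp add: g_def)
  have gs: "g x = 0" if "x \<notin> cball 0 R" for x using that by (simp add: g_def)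
  have gi: "integrable lborel g" by (rule integrable_compact_support[OF gc gs])
  have "(LINT x|lborel. g x) \<noteq> 0"
  proof
    assume 0: "(LINT x|lborel. g x) = 0"
    define x :: "real^'n" where "x = ((r + R) / 2) *\<^sub>R axis undefined 1"
    have "norm x = (r + R) / 2" using r by (simp add: x_def)
    moreover have "g x = 0" by (rule integral_compact_support_eq_0D[OF gc gs g0 0])
    ultimately show False using K r by (simp add: g_def max_def)
  qed
  moreover have "(LINT x|lborel. g x) \<ge> 0" using g0 by (intro integral_nonneg_AE) simp
  ultimately have "(LINT x|lborel. g x) > 0" by simp
  moreover have "(LINT x|lborel. g x) \<le> G_cutoff R k f"
    if f: "continuous_on UNIV f" "\<forall>x. f x \<ge> 0" "\<forall>x. x \<notin> cball 0 (R - R / k) \<longrightarrow> f x = rb" for f :: "real^'n \<Rightarrow> real"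
    unfolding G_cutoff_def
  proof (rule integral_mono[OF gi integrable_cutoff[OF f(1)]])
    show "g x \<le> f x * cutoff R k (norm x)" for x
    proof (cases "norm x \<le> r")
      case True
      then show ?thesis using f(2) cutoff_nonneg[of "norm x"] by (simp add: g_def)
    next
      case False
      have *: "max 0 (norm x - r) * (max 0 (R - norm x))\<^sup>2 \<le> R * (max 0 (R - norm x))\<^sup>2"
      proof (cases "norm x \<le> R")
        case True
        then show ?thesis using False r by (intro mult_right_mono) auto
      qed simp
      have "g x \<le> K * (R * (max 0 (R - norm x))\<^sup>2)"
        unfolding g_def using K * by (intro mult_left_mono) auto
      also have "\<dots> = rb * cutoff R k (norm x)"
        using False cutoff_outer[of "norm x"] R by (simp add: r_def K_def)
      also have "\<dots> = f x * cutoff R k (norm x)" using f(3) False by (simp add: r_def)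
      finally show ?thesis .
    qed
  qed
  ultimately show ?thesis by blast
qed

lemma G'_cutoff_eq:
  fixes f :: "real^'n \<Rightarrow> real"
  assumes "R0 < R - R / k" and out: "\<And>x. norm x \<ge> R0 \<Longrightarrow> v x = 0"
  shows "G'_cutoff R k f v = - (2 * cutoff_B R k) * (LINT x|lborel. f x * (x \<bullet> v x))"
proof -
  have "deriv (cutoff R k) (norm x) / norm x * (v x \<bullet> x) * f x =
      - (2 * cutoff_B R k) * (f x * (x \<bullet> v x))" for x
  proof (cases "x = 0 \<or> norm x \<ge> R0")
    case False
    then have "deriv (cutoff R k) (norm x) = - (2 * cutoff_B R k * norm x)"
      using assms(1) by (intro deriv_cutoff_inner) auto
    then show ?thesis using False by (simp add: inner_commute)
  qed (use out in auto)
  then show ?thesis by (simp add: G'_cutoff_def)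
qed

end

text \<open>
For \<open>N = 0\<close> the convention for division excludes \<open>G' = 0\<close>, because \<open>T > 0\<close>; the parabola is then a line.
\<close>

lemma discriminant_root:
  fixes B N G G' T :: real
  assumes "B > 0" "G'\<^sup>2 + 4 * B * N * G \<ge> 0" "T > 0"
    and T: "T = (if N = 0 then - G / G' else 1 / (2 * B * N) * (G' + sqrt (G'\<^sup>2 + 4 * B * N * G)))"
  shows "G + G' * T - B * N * T\<^sup>2 = 0"
proof (cases "N = 0")
  case True
  then have "G' \<noteq> 0" "T = - G / G'" using T assms(3) by auto
  then show ?thesis using True by simp
next
  case False
  define s where "s = sqrt (G'\<^sup>2 + 4 * B * N * G)"
  have s: "s * s = G' * G' + 4 * (B * N) * G"
    using assms(2) by (simp add: s_def power2_eq_square)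
  have BN: "B * N \<noteq> 0" using False assms(1) by simp
  have BT: "2 * (B * N) * T = G' + s" using T False BN by (simp add: s_def)
  have "4 * (B * N) * (G + G' * T - B * N * T\<^sup>2)
      = 4 * (B * N) * G + 2 * G' * (2 * (B * N) * T) - (2 * (B * N) * T) * (2 * (B * N) * T)"
    by (simp add: algebra_simps power2_eq_square)
  also have "\<dots> = 0" unfolding BT using s by (simp add: algebra_simps)
  finally show ?thesis using BN by simp
qed

section \<open>The solution cannot exist up to the root of the virial parabola\<close>

locale perturbed_background =
  fixes \<gamma> rb pb R0 \<sigma> :: real and \<rho>0 p0 :: "real^'n \<Rightarrow> real" and V0 :: "real^'n \<Rightarrow> real^'n"
  assumes gamma: "\<gamma> > 1" and background: "rb > 0" "pb > 0" and sigma: "\<sigma> = sqrt (\<gamma> * pb / rb)"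
    and perturbation: "\<And>x. norm x \<ge> R0 \<Longrightarrow> V0 x = 0 \<and> \<rho>0 x = rb \<and> p0 x = pb"
begin

lemma sigma_pos: "\<sigma> > 0"
  using gamma background by (simp add: sigma)

text \<open>
The backward cone with apex \<open>(x, t)\<close> meets the initial time in the ball around \<open>x\<close> of radius
\<open>\<sigma> * t < norm x - R0\<close>, where the data are constant.
\<close>

lemma finite_speed:
  assumes sol: "cauchy_solution \<gamma> \<rho>0 V0 p0 \<Omega> \<rho> V p S" and dom: "UNIV \<times> {0..<T} \<subseteq> \<Omega>"
    and t: "t \<in> {0..<T}" and x: "R0 + \<sigma> * t < norm x"
  shows "V (x, t) = 0 \<and> \<rho> (x, t) = rb \<and> p (x, t) = pb"
proof -
  interpret euler_flow \<gamma> \<Omega> \<rho> V p S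
    using sol gamma by unfold_locales (simp_all add: cauchy_solution_def)
  show ?thesis
  proof (rule domain_of_dependence[OF background sigma open_UNIV subset_UNIV, of 0 t "norm x - R0"])
    show "UNIV \<times> {0..t} \<subseteq> \<Omega>" using dom t by auto
    show "V (y, 0) = 0 \<and> \<rho> (y, 0) = rb \<and> p (y, 0) = pb" if "y \<in> ball x (norm x - R0)" for y
    proof -
      have "norm y \<ge> R0" using that norm_triangle_ineq3[of x y] by (simp add: dist_norm)
      then show ?thesis using perturbation sol by (simp add: cauchy_solution_def)
    qed
  qed (use t x in auto)
qed

text \<open>
The parabola bounds the weighted mass from above on the whole time interval and is nonpositive at its
end, but the weighted mass has a positive lower bound that is uniform in time.
\<close>

lemma no_solution_up_to:
  fixes R k n \<delta> \<omega> B N e0 G0 G0' T1 T2 :: real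
  assumes n: "n = real CARD('n)" and \<rho>0: "continuous_on UNIV \<rho>0"
    and Rk: "R > 0" "k > 1"
    and delta: "\<delta> = min 2 (n * (\<gamma> - 1))"
    and omega: "\<omega> = measure lborel (ball (0 :: real^'n) 1)"
    and B: "B = cutoff_B R k"
    and e0: "e0 = energy \<gamma> pb R0 \<rho>0 V0 p0"
    and G0: "G0 = G_cutoff R k \<rho>0"
    and G0': "G0' = G'_cutoff R k \<rho>0 V0"
    and N: "N = \<delta> * e0 + \<omega> * R ^ CARD('n) * pb * ((k - 1) / k) ^ CARD('n) * (\<delta> / (\<gamma> - 1) - n)"
    and radius: "R0 + \<sigma> * T1 \<le> R - R / k"
    and T1: "0 < T1" "G0 + G0' * T1 - B * N * T1\<^sup>2 \<le> 0"
  shows "\<not> cauchy_solution \<gamma> \<rho>0 V0 p0 \<Omega> \<rho> V p S \<or> \<not> UNIV \<times> {0..<T1} \<subseteq> \<Omega>"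
proof (rule ccontr)
  assume "\<not> ?thesis"
  then have sol: "cauchy_solution \<gamma> \<rho>0 V0 p0 \<Omega> \<rho> V p S" and dom: "UNIV \<times> {0..<T1} \<subseteq> \<Omega>" by auto
  interpret euler_flow \<gamma> \<Omega> \<rho> V p S
    using sol gamma by unfold_locales (simp_all add: cauchy_solution_def)
  define r where "r = R - R / k"
  have r: "0 < r" "r < R" using core_radius[OF Rk] by (auto simp: r_def)
  have B0: "B > 0" using cutoff_B_pos[OF Rk] by (simp add: B)
  have R0r: "R0 < r" using radius T1 sigma_pos by (smt (verit) mult_pos_pos r_def)
  have init: "\<rho> (x, 0) = \<rho>0 x" "V (x, 0) = V0 x" "p (x, 0) = p0 x" for x
    using sol by (auto simp: cauchy_solution_def)
  have out: "V (x, t) = 0 \<and> \<rho> (x, t) = rb \<and> p (x, t) = pb" if "t \<in> {0..<T1}" "x \<notin> cball 0 r" for x t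
  proof (rule finite_speed[OF sol dom that(1)])
    have "\<sigma> * t \<le> \<sigma> * T1" using that sigma_pos by simp
    then show "R0 + \<sigma> * t < norm x" using radius that(2) by (simp add: r_def)
  qed
  have out0: "x \<notin> cball 0 r \<Longrightarrow> \<rho>0 x = rb" for x using perturbation[of x] R0r by auto
  have e0': "e0 = (1 / 2) * (LINT x|lborel. \<rho> (x, 0) * (V (x, 0) \<bullet> V (x, 0)))
       + (1 / (\<gamma> - 1)) * (LINT x|lborel. p (x, 0) - pb)"
  proof -
    have "(\<lambda>x. indicator (ball 0 R0) x *\<^sub>R (p0 x - pb)) = (\<lambda>x. p0 x - pb)"
      using perturbation by (auto simp: fun_eq_iff indicator_def)
    then show ?thesis
      by (simp add: e0 energy_def init set_lebesgue_integral_def power2_norm_eq_inner)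
  qed
  have N': "N = \<delta> * e0 + measure lborel (cball (0 :: real^'n) r) * pb * (\<delta> / (\<gamma> - 1) - n)"
  proof -
    have "r = R * ((k - 1) / k)" using Rk by (simp add: r_def field_simps)
    then have rn: "r ^ CARD('n) = R ^ CARD('n) * ((k - 1) / k) ^ CARD('n)"
      by (simp only: power_mult_distrib)
    have "measure lborel (cball (0 :: real^'n) r) = \<omega> * r ^ CARD('n)"
      using r by (simp add: omega content_cball content_ball)
    then have "measure lborel (cball (0 :: real^'n) r) = \<omega> * R ^ CARD('n) * ((k - 1) / k) ^ CARD('n)"
      unfolding rn by simp
    then show ?thesis by (simp add: N mult_ac)
  qed
  have G0'_eq: "G0' = - (2 * B) * (LINT x|lborel. \<rho>0 x * (x \<bullet> V0 x))"
    unfolding G0' B by (rule G'_cutoff_eq[OF Rk, of R0]) (use R0r perturbation in \<open>auto simp: r_def\<close>)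
  obtain c where c: "c > 0" "\<And>f :: real^'n \<Rightarrow> real. continuous_on UNIV f \<Longrightarrow> (\<And>x. f x \<ge> 0) \<Longrightarrow>
      (\<And>x. x \<notin> cball 0 r \<Longrightarrow> f x = rb) \<Longrightarrow> c \<le> G_cutoff R k f"
    using G_cutoff_lower_bound[OF Rk background(1), where 'n = 'n] unfolding r_def by metis
  let ?q = "\<lambda>t. G0 + G0' * t - B * N * t\<^sup>2"
  have q: "c \<le> ?q t" if t: "t \<in> {0..<T1}" for t
  proof -
    have cont: "continuous_on UNIV (\<lambda>x. \<rho> (x, t))"
      by (rule continuous_on_slice[OF continuous_on_subset[OF C1_on_continuous[OF C1(1)] dom] t])
    have "c \<le> G_cutoff R k (\<lambda>x. \<rho> (x, t))"
    proof (rule c(2)[OF cont])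
      show "\<rho> (x, t) \<ge> 0" for x using rho_nonneg dom t by blast
    qed (use out[OF t] in blast)
    also have "\<dots> = (LINT x|lborel. (\<rho> (x, t) - rb) * (1 - B * (x \<bullet> x)))
        + rb * (LINT x|lborel. cutoff R k (norm (x :: real^'n)))"
      unfolding B by (rule G_cutoff_eq[OF Rk cont]) (use out[OF t] in \<open>simp add: r_def\<close>)
    also have "(LINT x|lborel. (\<rho> (x, t) - rb) * (1 - B * (x \<bullet> x))) \<le>
       (LINT x|lborel. (\<rho> (x, 0) - rb) * (1 - B * (x \<bullet> x)))
       - 2 * B * (LINT x|lborel. \<rho> (x, 0) * (x \<bullet> V (x, 0))) * t - B * N * t\<^sup>2"
      by (rule virial_upper_bound[OF dom out _ n delta e0' N' _ t]) (use background B0 in auto)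
    also have "(LINT x|lborel. (\<rho> (x, 0) - rb) * (1 - B * (x \<bullet> x))) =
       G0 - rb * (LINT x|lborel. cutoff R k (norm (x :: real^'n)))"
      unfolding init G0 B using G_cutoff_eq[OF Rk \<rho>0, of rb] out0 by (simp add: r_def)
    finally show ?thesis by (simp add: init G0'_eq)
  qed
  have "(?q \<longlongrightarrow> ?q T1) (at_left T1)" by (intro tendsto_intros)
  moreover have "\<forall>\<^sub>F t in at_left T1. c \<le> ?q t"
    using eventually_at_left_real[OF T1(1)] by eventually_elim (use q in auto)
  ultimately have "c \<le> ?q T1"
    by (rule tendsto_lowerbound) simp
  with c(1) T1(2) show False by simp
qed

end

section \<open>Continuation by the background state\<close>

text \<open>
The pointwise equations of a classical solution, separated from its domain: they depend only on the
functions near \<open>z\<close> and can be checked piecewise for functions that are glued together.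
\<close>

definition euler_equations_at ::
  "((real^'n) \<times> real \<Rightarrow> real) \<Rightarrow> ((real^'n) \<times> real \<Rightarrow> real^'n)
   \<Rightarrow> ((real^'n) \<times> real \<Rightarrow> real) \<Rightarrow> ((real^'n) \<times> real \<Rightarrow> real) \<Rightarrow> (real^'n) \<times> real \<Rightarrow> bool" where
  "euler_equations_at \<rho> V p S z \<longleftrightarrow>
        (\<forall>i. pd_t (\<lambda>y. \<rho> y * V y $ i) z
             + (\<Sum>j\<in>UNIV. pd_x j (\<lambda>y. \<rho> y * V y $ i * V y $ j) z) + pd_x i p z = 0) \<and>
        pd_t \<rho> z + (\<Sum>j\<in>UNIV. pd_x j (\<lambda>y. \<rho> y * V y $ j) z) = 0 \<and>
        pd_t S z + (\<Sum>j\<in>UNIV. V z $ j * pd_x j S z) = 0"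

lemma euler_equations_at_cong:
  assumes eq: "euler_equations_at \<rho> V p S z" and D: "open D" "z \<in> D"
    and same: "\<And>y. y \<in> D \<Longrightarrow> \<rho> y = \<rho>' y \<and> V y = V' y \<and> p y = p' y \<and> S y = S' y"
  shows "euler_equations_at \<rho>' V' p' S' z"
proof -
  have t: "pd_t f z = pd_t g z" and x: "pd_x j f z = pd_x j g z" if "\<And>y. y \<in> D \<Longrightarrow> f y = g y" for f g j
    unfolding pd_t_eq_dirderiv pd_x_eq_dirderiv by (rule dirderiv_cong_open[OF D that]; assumption)+
  have "pd_t \<rho> z = pd_t \<rho>' z" "pd_t S z = pd_t S' z" "pd_x j p z = pd_x j p' z" "pd_x j S z = pd_x j S' z"
    "pd_t (\<lambda>y. \<rho> y * V y $ i) z = pd_t (\<lambda>y. \<rho>' y * V' y $ i) z"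
    "pd_x j (\<lambda>y. \<rho> y * V y $ i) z = pd_x j (\<lambda>y. \<rho>' y * V' y $ i) z"
    "pd_x j (\<lambda>y. \<rho> y * V y $ i * V y $ j) z = pd_x j (\<lambda>y. \<rho>' y * V' y $ i * V' y $ j) z" for i j
    by (rule t x; simp add: same)+
  then show ?thesis using eq same[OF D(2)] by (simp add: euler_equations_at_def)
qed

lemma euler_equations_at_const: "euler_equations_at (\<lambda>z. a) (\<lambda>z. 0) (\<lambda>z. b) (\<lambda>z. c) z"
  by (simp add: euler_equations_at_def pd_t_rules pd_x_rules)

lemma Basis_real_vec_times_real:
  "i \<in> (Basis :: ((real^'n) \<times> real) set) \<Longrightarrow> norm i = 1 \<and> 0 \<le> snd i"
  by (auto simp: Basis_prod_def norm_Pair)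

text \<open>
At points with \<open>t = 0\<close> the derivative is one-sided in time. It is still unique, since every basis
direction can be followed for a short positive time without leaving the set.
\<close>

lemma has_derivative_const_unique:
  fixes f :: "(real^'n) \<times> real \<Rightarrow> 'b::real_normed_vector"
  assumes D: "open D" "x \<in> D" and t: "0 \<le> t" "t < T"
    and d: "(f has_derivative f') (at (x, t) within D \<times> {0..<T})"
    and const: "\<And>z. z \<in> D \<times> {0..<T} \<Longrightarrow> f z = c"
  shows "f' = (\<lambda>h. 0)"
proof -
  have z: "(x, t) \<in> D \<times> {0..<T}" using D t by simp
  have "(f has_derivative (\<lambda>h. 0)) (at (x, t) within D \<times> {0..<T})"
    by (rule has_derivative_transform[OF z const has_derivative_const])
  with d show ?thesis
  proof (rule frechet_derivative_unique_within)
    fix i :: "(real^'n) \<times> real" and e :: real assume i: "i \<in> Basis" "0 < e"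
    have "open (D \<times> {..<T})" "(x, t) \<in> D \<times> {..<T}" using D t by (auto intro: open_Times)
    then obtain \<epsilon> where \<epsilon>: "\<epsilon> > 0" "ball (x, t) \<epsilon> \<subseteq> D \<times> {..<T}"
      using open_contains_ball by blast
    define d where "d = min e \<epsilon> / 2"
    have d: "0 < d" "d < e" "d < \<epsilon>" using i \<epsilon>(1) by (auto simp: d_def)
    have "(x, t) + d *\<^sub>R i \<in> ball (x, t) \<epsilon>"
      using d Basis_real_vec_times_real[OF i(1)] by (simp add: dist_norm)
    then have "(x, t) + d *\<^sub>R i \<in> D \<times> {..<T}" using \<epsilon>(2) by blast
    moreover have "0 \<le> snd ((x, t) + d *\<^sub>R i)"
      using d t Basis_real_vec_times_real[OF i(1)] by simp
    ultimately have "(x, t) + d *\<^sub>R i \<in> D \<times> {0..<T}" by (auto simp: mem_Times_iff)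
    then show "\<exists>d. 0 < \<bar>d\<bar> \<and> \<bar>d\<bar> < e \<and> (x, t) + d *\<^sub>R i \<in> D \<times> {0..<T}"
      using d by (intro exI[of _ d]) auto
  qed
qed

text \<open>
The overlap \<open>a < norm x < b\<close>, where \<open>f\<close> is already constant, makes the two pieces fit: there the
derivative of \<open>f\<close> is zero, also at \<open>t = 0\<close>.
\<close>

lemma C1_on_extend_const:
  fixes f :: "(real^'n) \<times> real \<Rightarrow> 'b::real_normed_vector" and c :: 'b
  assumes f: "C1_on (ball 0 b \<times> {0..<T}) f" and ab: "a < b"
    and const: "\<And>x t. a < norm x \<Longrightarrow> norm x < b \<Longrightarrow> t \<in> {0..<T} \<Longrightarrow> f (x, t) = c"
  shows "C1_on (UNIV \<times> {0..<T}) (\<lambda>z. if norm (fst z) < b then f z else c)" (is "C1_on ?U ?g")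
proof -
  let ?A = "ball (0 :: real^'n) b \<times> {0..<T}"
  define K where "K = - cball (0 :: real^'n) a"
  let ?K = "K \<times> {0..<T}"
  have oK: "open K" by (simp add: K_def open_Compl)
  obtain f' where f': "\<And>z. z \<in> ?A \<Longrightarrow> (f has_derivative blinfun_apply (f' z)) (at z within ?A)"
    and cont: "continuous_on ?A f'" using f unfolding C1_on_def by blast
  define g' where "g' = (\<lambda>z. if norm (fst z) < b then f' z else 0)"
  have gc: "?g z = c" if "z \<in> ?K" for z
    using that const by (cases z) (auto simp: K_def)
  have f'0: "f' z = 0" if z: "z \<in> ?A" "z \<in> ?K" for z
  proof -
    obtain x t where xt: "z = (x, t)" by (cases z)
    have "blinfun_apply (f' z) = (\<lambda>h. 0)"
    proof (rule has_derivative_const_unique)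
      show "open (ball 0 b \<inter> K)" "x \<in> ball 0 b \<inter> K" using z oK by (auto simp: xt)
      show "0 \<le> t" "t < T" using z by (auto simp: xt)
      show "(f has_derivative blinfun_apply (f' z)) (at (x, t) within (ball 0 b \<inter> K) \<times> {0..<T})"
        using f'[OF z(1)] unfolding xt by (rule has_derivative_subset) auto
      show "f y = c" if "y \<in> (ball 0 b \<inter> K) \<times> {0..<T}" for y
        using that const by (cases y) (auto simp: K_def)
    qed
    then show ?thesis by (intro blinfun_eqI) (simp only: zero_blinfun.rep_eq)
  qed
  have U: "?U = ?A \<union> ?K" using ab by (auto simp: K_def)
  have oA: "openin (top_of_set (?A \<union> ?K)) ?A"
    unfolding U[symmetric] openin_open by (rule exI[of _ "ball 0 b \<times> UNIV"]) (auto intro: open_Times)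
  have oB: "openin (top_of_set (?A \<union> ?K)) ?K"
    unfolding U[symmetric] openin_open by (rule exI[of _ "K \<times> UNIV"]) (auto intro: open_Times oK)
  have "continuous_on ?A g'"
    by (rule continuous_on_cong[THEN iffD1, rotated 2, OF cont]) (auto simp: g'_def)
  moreover have "continuous_on ?K g'"
    by (rule continuous_on_cong[THEN iffD1, rotated 2, OF continuous_on_const[of _ 0]])
      (auto simp: g'_def f'0)
  ultimately have cg: "continuous_on ?U g'"
    unfolding U by (rule continuous_on_Un_local_open[OF oA oB])
  have "(?g has_derivative blinfun_apply (g' z)) (at z within ?U)" if z: "z \<in> ?U" for z
  proof (cases "z \<in> ?A")
    case True
    have "at z within ?A = at z within ?U"
      by (rule at_within_nhd[of _ "ball 0 b \<times> UNIV"]) (use True in \<open>auto intro: open_Times\<close>)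
    moreover have "(?g has_derivative blinfun_apply (f' z)) (at z within ?A)"
      by (rule has_derivative_transform[OF True _ f'[OF True]]) auto
    ultimately show ?thesis using True by (auto simp: g'_def)
  next
    case False
    then have zK: "z \<in> ?K" using z U by blast
    have "at z within ?K = at z within ?U"
      by (rule at_within_nhd[of _ "K \<times> UNIV"]) (use zK oK in \<open>auto intro: open_Times\<close>)
    moreover have "(?g has_derivative (\<lambda>h. 0)) (at z within ?K)"
      by (rule has_derivative_transform[OF zK gc has_derivative_const])
    moreover have "g' z = 0" using False z by (auto simp: g'_def)
    ultimately show ?thesis by (simp add: zero_blinfun.rep_eq)
  qed
  with cg show ?thesis unfolding C1_on_def by blast
qed

context perturbed_background
begin

text \<open>
At time \<open>T\<close> the perturbation is still at a positive distance \<open>4 * d\<close> from the boundary of the ball. By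
continuity the continued solution is the background state at time \<open>T\<close> in the outer part of the ball,
and by finite speed of propagation it remains so for a short time in an annulus well inside this part.
Outside of the annulus it can be replaced by the background state without loss of smoothness.
\<close>

lemma continuable_if_continuable_inside:
  assumes sol: "cauchy_solution \<gamma> \<rho>0 V0 p0 (UNIV \<times> {0..<T}) \<rho> V p S" and T: "T > 0" "R0 + \<sigma> * T < R"
    and inside: "T < T'" "continuable \<gamma> (UNIV \<times> {0..<T}) (UNIV \<times> {0..<T} \<union> cball 0 R \<times> {0..<T'}) \<rho> V p S"
  shows "\<exists>T'>T. continuable \<gamma> (UNIV \<times> {0..<T}) (UNIV \<times> {0..<T'}) \<rho> V p S"
proof -
  define \<Omega> where "\<Omega> = UNIV \<times> {0..<T} \<union> cball (0 :: real^'n) R \<times> {0..<T'}"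
  obtain \<rho>1 V1 p1 S1 where sol1: "euler_solution \<gamma> \<Omega> \<rho>1 V1 p1 S1"
    and same: "\<And>z. z \<in> UNIV \<times> {0..<T} \<Longrightarrow> \<rho>1 z = \<rho> z \<and> V1 z = V z \<and> p1 z = p z \<and> S1 z = S z"
    using inside(2) unfolding continuable_def \<Omega>_def by blast
  interpret e: euler_flow \<gamma> \<Omega> \<rho>1 V1 p1 S1
    using sol1 gamma by unfold_locales
  have csol1: "cauchy_solution \<gamma> \<rho>0 V0 p0 \<Omega> \<rho>1 V1 p1 S1"
    using sol sol1 same T(1) by (simp add: cauchy_solution_def)
  define rT where "rT = R0 + \<sigma> * T"
  define d where "d = (R - rT) / 4"
  have "4 * d = R - rT" by (simp add: d_def)
  then have d: "d > 0" "R = rT + 4 * d" using T(2) unfolding rT_def by linarith+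
  \<comment> \<open>In this time a signal travels at most \<open>d / 2\<close>, less than the distance \<open>d\<close> of the annulus used below to
    the region where the state at time \<open>T\<close> is unknown.\<close>
  define T2 where "T2 = min T' (T + d / (2 * \<sigma>))"
  have "0 < d / (2 * \<sigma>)" using d sigma_pos by simp
  then have T2: "T < T2" "T2 \<le> T'" "T2 \<le> T + d / (2 * \<sigma>)" using inside(1) by (auto simp: T2_def)
  have before: "V1 (x, t) = 0 \<and> \<rho>1 (x, t) = rb \<and> p1 (x, t) = pb" if "t \<in> {0..<T}" "rT < norm x" for x t
  proof (rule finite_speed[OF csol1 _ that(1)])
    show "UNIV \<times> {0..<T} \<subseteq> \<Omega>" by (auto simp: \<Omega>_def)
    have "\<sigma> * t \<le> \<sigma> * T" using that(1) sigma_pos by simp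
    then show "R0 + \<sigma> * t < norm x" using that(2) by (simp add: rT_def)
  qed
  have at_T: "V1 (x, T) = 0 \<and> \<rho>1 (x, T) = rb \<and> p1 (x, T) = pb" if x: "rT < norm x" "norm x < R" for x
  proof -
    have lim: "f (x, T) = c" if f: "continuous_on \<Omega> f" "\<And>t. t \<in> {0..<T} \<Longrightarrow> f (x, t) = c"
      for f :: "(real^'n) \<times> real \<Rightarrow> 'b::t1_space" and c
    proof -
      have cl: "closure {0..<T} = {0..T}" using T(1) by simp
      have "continuous_on {0..T} (\<lambda>t. f (x, t))"
        by (rule continuous_on_compose2[OF f(1)])
          (use x inside(1) in \<open>auto simp: \<Omega>_def intro!: continuous_intros\<close>)
      then show ?thesis
        by (intro continuous_constant_on_closure[of "{0..<T}" "\<lambda>t. f (x, t)" c T, unfolded cl])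
          (use f(2) T(1) in auto)
    qed
    have V1: "continuous_on \<Omega> V1" using sol1 by (auto simp: euler_solution_def C1_on_continuous)
    have "V1 (x, T) = 0" by (rule lim[OF V1]) (use before[OF _ x(1)] in simp)
    moreover have "\<rho>1 (x, T) = rb"
      by (rule lim[OF C1_on_continuous[OF e.C1(1)]]) (use before[OF _ x(1)] in simp)
    moreover have "p1 (x, T) = pb"
      by (rule lim[OF C1_on_continuous[OF e.C1(2)]]) (use before[OF _ x(1)] in simp)
    ultimately show ?thesis by simp
  qed
  have annulus: "V1 (x, t) = 0 \<and> \<rho>1 (x, t) = rb \<and> p1 (x, t) = pb"
    if x: "rT + d < norm x" "norm x < rT + 2 * d" and t: "t \<in> {0..<T2}" for x t
  proof (cases "t < T")
    case True
    then show ?thesis using before x t d by auto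
  next
    case False
    have tri: "norm y \<le> norm x + dist x y" "norm x \<le> norm y + dist x y" for y
      using norm_triangle_ineq3[of x y] by (auto simp: dist_norm)
    show ?thesis
    proof (rule e.domain_of_dependence[OF background sigma open_ball, of x d 0 R T t])
      show "cball x d \<subseteq> ball 0 R"
      proof
        fix y assume "y \<in> cball x d"
        then show "y \<in> ball 0 R" using tri(1)[of y] x d by simp
      qed
      show "ball 0 R \<times> {T..t} \<subseteq> \<Omega>" using t T2 T(1) by (auto simp: \<Omega>_def)
      show "T \<le> t" using False by simp
      have "\<sigma> * (t - T) \<le> \<sigma> * (d / (2 * \<sigma>))" using t T2 sigma_pos by (intro mult_left_mono) auto
      also have "\<dots> < d" using sigma_pos d by simp
      finally show "\<sigma> * (t - T) < d" .
      show "V1 (y, T) = 0 \<and> \<rho>1 (y, T) = rb \<and> p1 (y, T) = pb" if "y \<in> ball x d" for y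
        using that tri[of y] x d by (intro at_T) auto
    qed
  qed
  \<comment> \<open>The background entropy, determined by the equation of state.\<close>
  define s where "s = ln (pb / rb powr \<gamma>)"
  have s: "pb = exp s * rb powr \<gamma>" using background by (simp add: s_def)
  have S_eq: "S1 z = s" if "z \<in> \<Omega>" "\<rho>1 z = rb" "p1 z = pb" for z
  proof -
    have "exp (S1 z) = exp s" using e.p_eq[OF that(1)] that s background by simp
    then show ?thesis by simp
  qed
  define b where "b = rT + 2 * d"
  have b: "rT + d < b" "b < R" using d by (auto simp: b_def)
  let ?A = "ball (0 :: real^'n) b \<times> {0..<T2}"
  have A: "?A \<subseteq> \<Omega>" using b T2 by (auto simp: \<Omega>_def)
  have annulus': "V1 (x, t) = 0" "\<rho>1 (x, t) = rb" "p1 (x, t) = pb" "S1 (x, t) = s"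
    if "rT + d < norm x" "norm x < b" "t \<in> {0..<T2}" for x t
  proof -
    show *: "V1 (x, t) = 0" "\<rho>1 (x, t) = rb" "p1 (x, t) = pb"
      using annulus[of x t] that by (auto simp: b_def)
    have "(x, t) \<in> \<Omega>" using A that by auto
    then show "S1 (x, t) = s" using * by (intro S_eq)
  qed
  define \<rho>2 where "\<rho>2 = (\<lambda>z. if norm (fst z) < b then \<rho>1 z else rb)"
  define V2 where "V2 = (\<lambda>z. if norm (fst z) < b then V1 z else 0)"
  define p2 where "p2 = (\<lambda>z. if norm (fst z) < b then p1 z else pb)"
  define S2 where "S2 = (\<lambda>z. if norm (fst z) < b then S1 z else s)"
  note def2 = \<rho>2_def V2_def p2_def S2_def
  have V1C: "C1_on \<Omega> V1" using sol1 by (simp add: euler_solution_def)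
  have C1: "C1_on (UNIV \<times> {0..<T2}) \<rho>2" "C1_on (UNIV \<times> {0..<T2}) V2"
    "C1_on (UNIV \<times> {0..<T2}) p2" "C1_on (UNIV \<times> {0..<T2}) S2"
    unfolding def2
    by (rule C1_on_extend_const[OF _ b(1)]; (rule C1_on_subset[OF _ A])?;
        use e.C1 V1C annulus' in \<open>assumption | simp\<close>)+
  have eqs: "euler_equations_at \<rho>2 V2 p2 S2 z" if z: "z \<in> UNIV \<times> {0<..<T2}" for z
  proof (cases "norm (fst z) < b")
    case True
    have o: "open (ball (0 :: real^'n) b \<times> {0<..<T2})" by (auto intro: open_Times)
    have "ball (0 :: real^'n) b \<times> {0<..<T2} \<subseteq> interior \<Omega>"
      by (rule interior_maximal[OF _ o]) (use A in auto)
    moreover have zb: "z \<in> ball 0 b \<times> {0<..<T2}" using z True by (auto simp: mem_Times_iff)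
    ultimately have "z \<in> interior \<Omega>" by blast
    then have "euler_equations_at \<rho>1 V1 p1 S1 z"
      using sol1 by (auto simp: euler_solution_def euler_equations_at_def)
    then show ?thesis
      by (rule euler_equations_at_cong[OF _ o zb]) (auto simp: def2)
  next
    case False
    have o: "open ((- cball (0 :: real^'n) (rT + d)) \<times> {0<..<T2})" by (auto intro!: open_Times)
    have zb: "z \<in> (- cball 0 (rT + d)) \<times> {0<..<T2}" using z False b by (auto simp: mem_Times_iff)
    show ?thesis
      by (rule euler_equations_at_cong[OF euler_equations_at_const[of rb pb s] o zb])
        (auto simp: def2 annulus')
  qed
  have "euler_solution \<gamma> (UNIV \<times> {0..<T2}) \<rho>2 V2 p2 S2"
    unfolding euler_solution_def
  proof (intro conjI ballI C1)
    fix z assume z: "z \<in> (UNIV :: (real^'n) set) \<times> {0..<T2}"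
    show "0 \<le> \<rho>2 z" "p2 z = exp (S2 z) * \<rho>2 z powr \<gamma>"
    proof -
      have "z \<in> \<Omega>" if "norm (fst z) < b" using that z A by (auto simp: mem_Times_iff)
      then show "0 \<le> \<rho>2 z" "p2 z = exp (S2 z) * \<rho>2 z powr \<gamma>"
        using e.rho_nonneg[of z] e.p_eq[of z] s background by (auto simp: def2)
    qed
  next
    fix z assume "z \<in> interior ((UNIV :: (real^'n) set) \<times> {0..<T2})"
    then have "z \<in> UNIV \<times> {0<..<T2}" by (simp add: interior_Times)
    from eqs[OF this] show "\<forall>i. pd_t (\<lambda>y. \<rho>2 y * V2 y $ i) z
             + (\<Sum>j\<in>UNIV. pd_x j (\<lambda>y. \<rho>2 y * V2 y $ i * V2 y $ j) z) + pd_x i p2 z = 0"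
        "pd_t \<rho>2 z + (\<Sum>j\<in>UNIV. pd_x j (\<lambda>y. \<rho>2 y * V2 y $ j) z) = 0"
        "pd_t S2 z + (\<Sum>j\<in>UNIV. V2 z $ j * pd_x j S2 z) = 0"
      by (auto simp: euler_equations_at_def)
  qed
  moreover have "\<rho>2 z = \<rho> z \<and> V2 z = V z \<and> p2 z = p z \<and> S2 z = S z" if z: "z \<in> UNIV \<times> {0..<T}" for z
  proof -
    obtain x t where xt: "z = (x, t)" "t \<in> {0..<T}" using z by (cases z) auto
    have far: "V1 z = 0 \<and> \<rho>1 z = rb \<and> p1 z = pb \<and> S1 z = s" if "\<not> norm x < b"
    proof -
      have "V1 z = 0 \<and> \<rho>1 z = rb \<and> p1 z = pb"
        using before[OF xt(2), of x] that b d xt by auto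
      moreover have "z \<in> \<Omega>" using z by (auto simp: \<Omega>_def)
      ultimately show ?thesis using S_eq by blast
    qed
    show ?thesis using same[OF z] far xt by (auto simp: def2)
  qed
  ultimately have "continuable \<gamma> (UNIV \<times> {0..<T}) (UNIV \<times> {0..<T2}) \<rho> V p S"
    unfolding continuable_def by blast
  then show ?thesis using T2(1) by blast
qed

end

section \<open>Loss of smoothness inside the ball\<close>

theorem theorem1p3:
  fixes \<rho>0 p0 :: "real^'n \<Rightarrow> real" and V0 :: "real^'n \<Rightarrow> real^'n"
    and \<gamma> rhobar pbar R0 R k n \<delta> \<sigma> \<omega> B N e0 G0 G0' T1 T2 :: real
  assumes n: "n = real CARD('n)"
    and gamma: "\<gamma> > 1"
    and background: "rhobar > 0" "pbar > 0" "R0 > 0"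
    and smooth_data: "C1_on UNIV \<rho>0" "C1_on UNIV V0" "C1_on UNIV p0"
    and positive_data: "\<And>x. \<rho>0 x > 0" "\<And>x. p0 x > 0"
    and perturbation: "\<And>x. norm x \<ge> R0 \<Longrightarrow> V0 x = 0 \<and> \<rho>0 x = rhobar \<and> p0 x = pbar"
    and Rk: "R > 0" "k > n"
    and delta: "\<delta> = min 2 (n * (\<gamma> - 1))"
    and sigma: "\<sigma> = sqrt (\<gamma> * pbar / rhobar)"
    and omega: "\<omega> = measure lborel (ball (0 :: real^'n) 1)"
    and B: "B = cutoff_B R k"
    and e0: "e0 = energy \<gamma> pbar R0 \<rho>0 V0 p0"
    and G0: "G0 = G_cutoff R k \<rho>0"
    and G0': "G0' = G'_cutoff R k \<rho>0 V0"
    and N: "N = \<delta> * e0 + \<omega> * R ^ CARD('n) * pbar * ((k - 1) / k) ^ CARD('n) * (\<delta> / (\<gamma> - 1) - n)"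
    and T1_real: "G0'\<^sup>2 + 4 * B * N * G0 \<ge> 0"
    and T1: "T1 = (if N = 0 then - G0 / G0'
                   else 1 / (2 * B * N) * (G0' + sqrt (G0'\<^sup>2 + 4 * B * N * G0)))"
    and T2: "T2 = 1 / \<sigma> * ((k - 1) * R / k - R0)"
    and radius: "R0 < (k - 1) * R / k"
    and times: "0 < T1" "T1 \<le> T2"
  shows "loses_smoothness_within \<gamma> \<rho>0 V0 p0 T1 (cball 0 R)"
proof -
  interpret perturbed_background \<gamma> rhobar pbar R0 \<sigma> \<rho>0 p0 V0
    using gamma background sigma perturbation by unfold_locales auto
  have "CARD('n) \<ge> 1" by (simp add: Suc_leI)
  then have k: "k > 1" using n Rk by linarith
  have Bpos: "B > 0" using cutoff_B_pos[OF Rk(1) k] B by simp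
  have front: "R0 + \<sigma> * T1 \<le> R - R / k"
  proof -
    have "\<sigma> * T1 \<le> \<sigma> * T2" using times sigma_pos by simp
    also have "\<dots> = R - R / k - R0" using T2 sigma_pos k by (simp add: field_simps)
    finally show ?thesis by simp
  qed
  have q: "G0 + G0' * T1 - B * N * T1\<^sup>2 \<le> 0"
    using discriminant_root[OF Bpos T1_real times(1) T1] by simp
  have none: "\<not> cauchy_solution \<gamma> \<rho>0 V0 p0 \<Omega> \<rho> V p S" if "UNIV \<times> {0..<T1} \<subseteq> \<Omega>" for \<Omega> \<rho> V p S
    using no_solution_up_to[OF n C1_on_continuous[OF smooth_data(1)] Rk(1) k delta omega
        B e0 G0 G0' N front times(1) q] that by blast
  show ?thesis
    unfolding loses_smoothness_within_def
  proof (intro conjI allI impI)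
    show "\<nexists>\<rho> V p S. cauchy_solution \<gamma> \<rho>0 V0 p0 (UNIV \<times> {0..<T1} \<union> cball 0 R \<times> {T1}) \<rho> V p S"
      using none by blast
    fix T T' \<rho> V p S
    assume T: "0 < T" "T < T'" and sol: "cauchy_solution \<gamma> \<rho>0 V0 p0 (UNIV \<times> {0..<T}) \<rho> V p S"
      and maximal: "\<forall>T'>T. \<not> continuable \<gamma> (UNIV \<times> {0..<T}) (UNIV \<times> {0..<T'}) \<rho> V p S"
    have "T < T1"
    proof (rule ccontr)
      assume "\<not> T < T1"
      then have "UNIV \<times> {0..<T1} \<subseteq> (UNIV :: (real^'n) set) \<times> {0..<T}" by auto
      then show False using none sol by blast
    qed
    then have "\<sigma> * T < \<sigma> * T1" using sigma_pos by simp
    then have "R0 + \<sigma> * T < R" using front core_radius(2)[OF Rk(1) k] by simp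
    then show "\<not> continuable \<gamma> (UNIV \<times> {0..<T}) (UNIV \<times> {0..<T} \<union> cball 0 R \<times> {0..<T'}) \<rho> V p S"
      using continuable_if_continuable_inside[OF sol T(1) _ T(2)] maximal by blast
  qed
qed

end
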